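(* Let $AX=B$, where all entries of $X\in\mathbb{R}^{n\times m}$ are nonzero, $B=\sum_{k=1}^M\omega^B_kS_k\in\mathbb{R}^{n\times m}$ has a sparse representation with parameter vector $\Omega_B=(\omega_1^B,\dots,\omega_M^B)$, and $A\in\mathbb{R}^{n\times n}$ is a nonsingular $\{1;1\}$-quasiseparable matrix with a tangent-Givens-vector representation $\Omega_{GV}=(\{l_i\}_{i=2}^{n-1},\{v_i\}_{i=1}^{n-1},\{d_i\}_{i=1}^n,\{w_i\}_{i=1}^{n-1},\{u_i\}_{i=2}^{n-1})$. Write $A=A_L+A_D+A_U$ with $A_L$ strictly lower triangular, $A_D$ diagonal and $A_U$ strictly upper triangular. Let $0\le f\in\mathbb{R}^M$ and $$0\le\mathcal{E}_{GV}=\big(\{e_{l_i}\}_{i=2}^{n-1},\{e_{v_i}\}_{i=1}^{n-1},\{e_{d_i}\}_{i=1}^n,\{e_{w_i}\}_{i=1}^{n-1},\{e_{u_i}\}_{i=2}^{n-1}\big)\in\mathbb{R}^{5n-6}$$ be weight vectors, and suppose $\Omega_{GV}\cap\Omega_B=\emptyset$ (the parameters of $A$ and $B$ are independent). Then $$\begin{aligned}\mathscr{K}_{\mathcal{E}_{GV},f}(A(\Omega_{GV}),B(\Omega_B))=\frac{1}{\|X\|_{\max}}\Big\|&\sum_{k=1}^M|A^{-1}S_k|f_k+|A^{-1}||\mathcal{D}_d||X|+|A^{-1}A_L||\mathcal{D}_v||X|+|A^{-1}||\mathcal{D}_w||A_UX|\\&+\sum_{i=2}^{n-1}\left|A^{-1}\begin{bmatrix}0&0\\-s_i^2A(i,1:i-1)&0\\c_i^2A(i+1:n,1:i-1)&0\end{bmatrix}X\right|\left|\frac{e_{l_i}}{l_i}\right|\\&+\sum_{i=2}^{n-1}\left|A^{-1}\begin{bmatrix}0&-t_i^2A(1:i-1,i)&r_i^2A(1:i-1,i+1:n)\\0&0&0\end{bmatrix}X\right|\left|\frac{e_{u_i}}{u_i}\right|\Big\|_{\max},\end{aligned}$$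 where $\mathcal{D}_d=\mathrm{diag}(e_{d_1},\dots,e_{d_n})$, $\mathcal{D}_v=\mathrm{diag}\big(\frac{e_{v_1}}{v_1},\dots,\frac{e_{v_{n-1}}}{v_{n-1}},1\big)$, $\mathcal{D}_w=\mathrm{diag}\big(\frac{e_{w_1}}{w_1},\dots,\frac{e_{w_{n-1}}}{w_{n-1}},1\big)$.
   Context: Let $n\ge2$. A tangent-Givens-vector representation of a $\{1;1\}$-quasiseparable matrix $A\in\mathbb{R}^{n\times n}$ is a vector of $5n-6$ real parameters $\Omega_{GV}=(\{l_i\}_{i=2}^{n-1},\{v_i\}_{i=1}^{n-1},\{d_i\}_{i=1}^n,\{w_i\}_{i=1}^{n-1},\{u_i\}_{i=2}^{n-1})$ such that, with $$c_i=\frac1{\sqrt{1+l_i^2}},\quad s_i=\frac{l_i}{\sqrt{1+l_i^2}},\quad r_i=\frac1{\sqrt{1+u_i^2}},\quad t_i=\frac{u_i}{\sqrt{1+u_i^2}}\quad(i=2,\dots,n-1),\qquad c_n:=r_n:=1,$$ one has $A(i,i)=d_i$, $A(i,j)=c_is_{i-1}s_{i-2}\cdots s_{j+1}v_j$ for $i>j$, and $A(i,j)=w_it_{i+1}t_{i+2}\cdots t_{j-1}r_j$ for $i<j$ (empty products equal 1). Sparse representation of $B$: $B=\sum_{k=1}^M\omega_k^BS_k$, where the $S_k\in\mathbb{R}^{n\times m}$ are fixed constant matrices (typically with entries 0 and 1, describing the sparsity pattern) and $\Omega_B=(\omega^B_1,\dots,\omega^B_M)$ are independent real parameters, independent of those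 of $A$. Notation: $|Z|$ is the entrywise absolute value, $\|Z\|_{\max}=\max_{i,j}|z_{ij}|$, inequalities are entrywise. $A(i_1:i_2,j_1:j_2)$ is the submatrix with rows $i_1,\dots,i_2$ and columns $j_1,\dots,j_2$. The displayed block matrices are $n\times n$: in the first, row $i$, columns $1,\dots,i-1$ carry $-s_i^2A(i,1:i-1)$, rows $i+1,\dots,n$, columns $1,\dots,i-1$ carry $c_i^2A(i+1:n,1:i-1)$, and all other entries are zero; in the second, rows $1,\dots,i-1$ of column $i$ carry $-t_i^2A(1:i-1,i)$, rows $1,\dots,i-1$, columns $i+1,\dots,n$ carry $r_i^2A(1:i-1,i+1:n)$, and all other entries are zero. Convention for quotients: whenever the denominator parameter in a quotient such as $e_{l_i}/l_i$ is zero, the corresponding weight is required to be zero and the quotient is understood to be zero. Condition number: $$\mathscr{K}_{\mathcal{E}_{GV},f}(A(\Omega_{GV}),B(\Omega_B)):=\lim_{\eta\to0}\sup\left\{\frac1\eta\frac{\|\delta X\|_{\max}}{\|X\|_{\max}}: A(\Omega_{GV}+\delta\Omega_{GV})(X+\delta X)=B(\Omega_B+\delta\Omega_B),\ |\delta\Omega_{GV}|\le\eta\,\mathcal{E}_{GV},\ |\delta\Omega_B|\le\eta f\right\},$$ with $\eta>0$; $|\delta\Omega_{GV}|\le\eta\,\mathcal{E}_{GV}$ means that each parameter $\zeta$ is perturbed by at most $\eta e_\zeta$. *)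

theory Defs
  imports
    "HOL-Analysis.Analysis"
    "Jordan_Normal_Form.Gauss_Jordan_Elimination"
    "Jordan_Normal_Form.DL_Rank"
    "Jordan_Normal_Form.DL_Submatrix"
begin

section \<open>Entrywise matrix operations\<close>

definition abs_mat :: "real mat \<Rightarrow> real mat" where
  "abs_mat Z = map_mat abs Z"

text \<open>Only meaningful for matrices with at least one row and one column.\<close>
definition max_norm :: "real mat \<Rightarrow> real" where
  "max_norm Z = Max (abs ` elements_mat Z)"

definition mat_sum :: "nat \<Rightarrow> nat \<Rightarrow> ('i \<Rightarrow> real mat) \<Rightarrow> 'i set \<Rightarrow> real mat" where
  "mat_sum n m F I = mat n m (\<lambda>(p, q). \<Sum>k\<in>I. F k $$ (p, q))"

text \<open>A junk value unless \<open>A\<close> is square and nonsingular.\<close>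
definition mat_inv :: "real mat \<Rightarrow> real mat" where
  "mat_inv A = the (mat_inverse A)"

definition strict_lower :: "real mat \<Rightarrow> real mat" where
  "strict_lower A = mat (dim_row A) (dim_col A) (\<lambda>(p, q). if q < p then A $$ (p, q) else 0)"

definition strict_upper :: "real mat \<Rightarrow> real mat" where
  "strict_upper A = mat (dim_row A) (dim_col A) (\<lambda>(p, q). if p < q then A $$ (p, q) else 0)"

definition diag_part :: "real mat \<Rightarrow> real mat" where
  "diag_part A = mat (dim_row A) (dim_col A) (\<lambda>(p, q). if p = q then A $$ (p, q) else 0)"

lemma lower_diag_upper: "A = strict_lower A + diag_part A + strict_upper A"
  by (rule eq_matI) (auto simp: strict_lower_def diag_part_def strict_upper_def)


section \<open>Quasiseparable matrices and tangent-Givens-vector representations\<close>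

text \<open>
  Every submatrix lying in the strictly lower (upper) triangular part of \<open>A\<close> is contained in one
  of the blocks below, so it suffices to bound the ranks of these.
\<close>
definition quasiseparable :: "nat \<Rightarrow> nat \<Rightarrow> nat \<Rightarrow> real mat \<Rightarrow> bool" where
  "quasiseparable n nL nU A \<longleftrightarrow> A \<in> carrier_mat n n \<and>
     (\<forall>k\<in>{1..<n}. vec_space.rank (n - k) (submatrix A {k..<n} {0..<k}) \<le> nL \<and>
                 vec_space.rank k (submatrix A {0..<k} {k..<n}) \<le> nU)"

text \<open>
  Parameters keep their 1-based mathematical indices.  For order \<open>n\<close> only
  \<open>gl i\<close>, \<open>gu i\<close> with \<open>2 \<le> i \<le> n - 1\<close>, \<open>gv i\<close>, \<open>gw i\<close> with \<open>1 \<le> i \<le> n - 1\<close> and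
  \<open>gd i\<close> with \<open>1 \<le> i \<le> n\<close> are used: \<open>5 n - 6\<close> real numbers in total.  The same record type holds
  parameters, perturbations and weights.
\<close>
record gv_params =
  gl :: "nat \<Rightarrow> real"
  gv :: "nat \<Rightarrow> real"
  gd :: "nat \<Rightarrow> real"
  gw :: "nat \<Rightarrow> real"
  gu :: "nat \<Rightarrow> real"

definition gv_c :: "nat \<Rightarrow> gv_params \<Rightarrow> nat \<Rightarrow> real" where
  "gv_c n \<Omega> i = (if i = n then 1 else 1 / sqrt (1 + (gl \<Omega> i)\<^sup>2))"

definition gv_s :: "gv_params \<Rightarrow> nat \<Rightarrow> real" where
  "gv_s \<Omega> i = gl \<Omega> i / sqrt (1 + (gl \<Omega> i)\<^sup>2)"

definition gv_r :: "nat \<Rightarrow> gv_params \<Rightarrow> nat \<Rightarrow> real" where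
  "gv_r n \<Omega> i = (if i = n then 1 else 1 / sqrt (1 + (gu \<Omega> i)\<^sup>2))"

definition gv_t :: "gv_params \<Rightarrow> nat \<Rightarrow> real" where
  "gv_t \<Omega> i = gu \<Omega> i / sqrt (1 + (gu \<Omega> i)\<^sup>2)"

text \<open>The entry \<open>A(i,j)\<close>, with \<open>i\<close> and \<open>j\<close> counted from 1.\<close>
definition gv_entry :: "nat \<Rightarrow> gv_params \<Rightarrow> nat \<Rightarrow> nat \<Rightarrow> real" where
  "gv_entry n \<Omega> i j =
     (if j < i then gv_c n \<Omega> i * (\<Prod>k\<in>{j<..<i}. gv_s \<Omega> k) * gv \<Omega> j
      else if i < j then gw \<Omega> i * (\<Prod>k\<in>{i<..<j}. gv_t \<Omega> k) * gv_r n \<Omega> j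
      else gd \<Omega> i)"

text \<open>Library matrices are indexed from 0.\<close>
definition gv_mat :: "nat \<Rightarrow> gv_params \<Rightarrow> real mat" where
  "gv_mat n \<Omega> = mat n n (\<lambda>(p, q). gv_entry n \<Omega> (Suc p) (Suc q))"

definition gv_add :: "gv_params \<Rightarrow> gv_params \<Rightarrow> gv_params" where
  "gv_add \<Omega> \<Delta> =
     \<lparr> gl = (\<lambda>i. gl \<Omega> i + gl \<Delta> i), gv = (\<lambda>i. gv \<Omega> i + gv \<Delta> i), gd = (\<lambda>i. gd \<Omega> i + gd \<Delta> i),
       gw = (\<lambda>i. gw \<Omega> i + gw \<Delta> i), gu = (\<lambda>i. gu \<Omega> i + gu \<Delta> i) \<rparr>"

definition gv_nonneg :: "nat \<Rightarrow> gv_params \<Rightarrow> bool" where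
  "gv_nonneg n E \<longleftrightarrow>
     (\<forall>i\<in>{2..n-1}. 0 \<le> gl E i \<and> 0 \<le> gu E i) \<and>
     (\<forall>i\<in>{1..n-1}. 0 \<le> gv E i \<and> 0 \<le> gw E i) \<and>
     (\<forall>i\<in>{1..n}. 0 \<le> gd E i)"

definition gv_bounded :: "nat \<Rightarrow> real \<Rightarrow> gv_params \<Rightarrow> gv_params \<Rightarrow> bool" where
  "gv_bounded n \<eta> E \<Delta> \<longleftrightarrow>
     (\<forall>i\<in>{2..n-1}. \<bar>gl \<Delta> i\<bar> \<le> \<eta> * gl E i \<and> \<bar>gu \<Delta> i\<bar> \<le> \<eta> * gu E i) \<and>
     (\<forall>i\<in>{1..n-1}. \<bar>gv \<Delta> i\<bar> \<le> \<eta> * gv E i \<and> \<bar>gw \<Delta> i\<bar> \<le> \<eta> * gw E i) \<and>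
     (\<forall>i\<in>{1..n}. \<bar>gd \<Delta> i\<bar> \<le> \<eta> * gd E i)"

text \<open>
  Convention for the quotients \<open>e\<^sub>\<zeta> / \<zeta>\<close>: a zero parameter has zero weight.  The quotient is then
  zero because \<open>0 / 0 = 0\<close>.
\<close>
definition gv_quotients_ok :: "nat \<Rightarrow> gv_params \<Rightarrow> gv_params \<Rightarrow> bool" where
  "gv_quotients_ok n \<Omega> E \<longleftrightarrow>
     (\<forall>i\<in>{2..n-1}. (gl \<Omega> i = 0 \<longrightarrow> gl E i = 0) \<and> (gu \<Omega> i = 0 \<longrightarrow> gu E i = 0)) \<and>
     (\<forall>i\<in>{1..n-1}. (gv \<Omega> i = 0 \<longrightarrow> gv E i = 0) \<and> (gw \<Omega> i = 0 \<longrightarrow> gw E i = 0))"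


section \<open>Sparse right-hand sides and the condition number\<close>

definition sparse_mat :: "nat \<Rightarrow> nat \<Rightarrow> nat \<Rightarrow> (nat \<Rightarrow> real mat) \<Rightarrow> (nat \<Rightarrow> real) \<Rightarrow> real mat" where
  "sparse_mat n m M S \<omega> = mat_sum n m (\<lambda>k. \<omega> k \<cdot>\<^sub>m S k) {1..M}"

text \<open>
  The parameters of \<open>A\<close> and of \<open>B\<close> are perturbed independently of each other.  \<open>X\<close> is the solution
  of the unperturbed system \<open>gv_mat n \<Omega> * X = sparse_mat n m M S \<omega>\<close>.
\<close>
definition relative_changes ::
  "nat \<Rightarrow> nat \<Rightarrow> nat \<Rightarrow> (nat \<Rightarrow> real mat) \<Rightarrow> gv_params \<Rightarrow> (nat \<Rightarrow> real) \<Rightarrow> gv_params \<Rightarrow> (nat \<Rightarrow> real) \<Rightarrow>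
   real mat \<Rightarrow> real \<Rightarrow> real set" where
  "relative_changes n m M S \<Omega> \<omega> E f X \<eta> =
     {1 / \<eta> * (max_norm \<Delta>X / max_norm X) | \<Delta>X \<Delta> \<delta>.
        \<Delta>X \<in> carrier_mat n m \<and>
        gv_mat n (gv_add \<Omega> \<Delta>) * (X + \<Delta>X) = sparse_mat n m M S (\<lambda>k. \<omega> k + \<delta> k) \<and>
        gv_bounded n \<eta> E \<Delta> \<and> (\<forall>k\<in>{1..M}. \<bar>\<delta> k\<bar> \<le> \<eta> * f k)}"

text \<open>
  The supremum is taken in the extended reals, since for large \<open>\<eta>\<close> the perturbed matrix may become
  singular and the set above unbounded.
\<close>
definition sup_relative_change ::
  "nat \<Rightarrow> nat \<Rightarrow> nat \<Rightarrow> (nat \<Rightarrow> real mat) \<Rightarrow> gv_params \<Rightarrow> (nat \<Rightarrow> real) \<Rightarrow> gv_params \<Rightarrow> (nat \<Rightarrow> real) \<Rightarrow>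
   real mat \<Rightarrow> real \<Rightarrow> ereal" where
  "sup_relative_change n m M S \<Omega> \<omega> E f X \<eta> =
     Sup (ereal ` relative_changes n m M S \<Omega> \<omega> E f X \<eta>)"

definition cond_GV ::
  "nat \<Rightarrow> nat \<Rightarrow> nat \<Rightarrow> (nat \<Rightarrow> real mat) \<Rightarrow> gv_params \<Rightarrow> (nat \<Rightarrow> real) \<Rightarrow> gv_params \<Rightarrow> (nat \<Rightarrow> real) \<Rightarrow>
   real mat \<Rightarrow> ereal" where
  "cond_GV n m M S \<Omega> \<omega> E f X = Lim (at_right 0) (sup_relative_change n m M S \<Omega> \<omega> E f X)"


section \<open>The matrices in the condition number formula\<close>

definition D_d :: "nat \<Rightarrow> gv_params \<Rightarrow> real mat" where
  "D_d n E = mat_diag n (\<lambda>p. gd E (Suc p))"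

definition D_v :: "nat \<Rightarrow> gv_params \<Rightarrow> gv_params \<Rightarrow> real mat" where
  "D_v n \<Omega> E = mat_diag n (\<lambda>p. if Suc p < n then gv E (Suc p) / gv \<Omega> (Suc p) else 1)"

definition D_w :: "nat \<Rightarrow> gv_params \<Rightarrow> gv_params \<Rightarrow> real mat" where
  "D_w n \<Omega> E = mat_diag n (\<lambda>p. if Suc p < n then gw E (Suc p) / gw \<Omega> (Suc p) else 1)"

text \<open>
  The block matrices \<open>[0 0; -s\<^sub>i\<^sup>2 A(i,1:i-1) 0; c\<^sub>i\<^sup>2 A(i+1:n,1:i-1) 0]\<close> and
  \<open>[0 -t\<^sub>i\<^sup>2 A(1:i-1,i) r\<^sub>i\<^sup>2 A(1:i-1,i+1:n); 0 0 0]\<close>; the index \<open>i\<close> counts from 1.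
\<close>
definition lower_block :: "nat \<Rightarrow> gv_params \<Rightarrow> real mat \<Rightarrow> nat \<Rightarrow> real mat" where
  "lower_block n \<Omega> A i = mat n n (\<lambda>(p, q).
     if Suc q < i \<and> Suc p = i then - (gv_s \<Omega> i)\<^sup>2 * A $$ (p, q)
     else if Suc q < i \<and> i < Suc p then (gv_c n \<Omega> i)\<^sup>2 * A $$ (p, q)
     else 0)"

definition upper_block :: "nat \<Rightarrow> gv_params \<Rightarrow> real mat \<Rightarrow> nat \<Rightarrow> real mat" where
  "upper_block n \<Omega> A i = mat n n (\<lambda>(p, q).
     if Suc p < i \<and> Suc q = i then - (gv_t \<Omega> i)\<^sup>2 * A $$ (p, q)
     else if Suc p < i \<and> i < Suc q then (gv_r n \<Omega> i)\<^sup>2 * A $$ (p, q)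
     else 0)"

end

theory Submission
  imports Defs "HOL-Library.Landau_Symbols"
begin

text \<open>
  If \<open>(A + \<delta>A)(X + \<delta>X) = B + \<delta>B\<close>, then \<open>\<delta>X = A\<inverse>(\<delta>B - \<delta>A X - \<delta>A \<delta>X)\<close>.  When every parameter moves by at
  most \<open>\<eta>\<close> times its weight, \<open>\<delta>A\<close> and \<open>\<delta>B\<close> are \<open>O(\<eta>)\<close>, so \<open>\<delta>X\<close> is \<open>O(\<eta>)\<close>, the product \<open>\<delta>A \<delta>X\<close> is
  negligible, and \<open>\<delta>X\<close> agrees up to \<open>o(\<eta>)\<close> with \<open>A\<inverse>(\<delta>B - dA X)\<close>, where \<open>dA\<close> is the differential of \<open>A\<close>
  in its parameters (\<open>perturbed_solution_first_order\<close>, \<open>gv_solution_first_order\<close>).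

  The differential has the shape seen in the formula because each entry of \<open>A\<close> is a product in which
  every parameter enters at most one factor.  Logarithmic derivatives add up over products, and for a
  tangent \<open>l\<close> with cosine \<open>c\<close> and sine \<open>s\<close> they are \<open>l c' / c = - s\<^sup>2\<close> and \<open>l s' / s = c\<^sup>2\<close>.  This is
  where the factors of the two block matrices come from, and why weights occur divided by parameters
  (\<open>gv_mat_first_order\<close>).

  Each entry \<open>(p, q)\<close> of \<open>A\<inverse>(\<delta>B - dA X)\<close> is therefore a linear form in the parameter perturbations.
  On the box in which every perturbation \<open>\<delta>\<zeta>\<close> satisfies \<open>\<bar>\<delta>\<zeta>\<bar> \<le> \<eta> e\<^sub>\<zeta>\<close>, a linear form is at most \<open>\<eta>\<close> times the
  weighted sum of the absolute values of its coefficients (\<open>abs_gv_form_le\<close>), and it reaches this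
  bound at a vertex of the box (\<open>gv_form_worst\<close>).  The weighted sum is the entry \<open>(p, q)\<close> of the
  matrix inside the norm (\<open>cond_matrix_entry\<close>).

  The bound gives the upper estimate of the supremum, provided the \<open>o(\<eta>)\<close> is uniform over all
  perturbations; this holds because the expansion is proved along an arbitrary filter, and one may
  take the filter on all tuples of a step size \<open>\<eta>\<close>, admissible perturbations and a resulting \<open>\<delta>X\<close> in which
  only \<open>\<eta>\<close> is controlled (\<open>relative_changes_upper\<close>).  The lower estimate follows the vertices
  belonging to a largest entry of the matrix as \<open>\<eta>\<close> tends to 0 (\<open>relative_changes_lower\<close>).
\<close>

section \<open>First-order expansions with relative differentials\<close>

text \<open>
  Writing the differential of \<open>f\<close> as \<open>a * g\<close> makes products additive in \<open>g\<close>.  Since \<open>a\<close> may vanish,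
  \<open>g\<close> is part of the data and cannot be recovered from \<open>f\<close>.
\<close>
definition rel_first_order ::
  "'z filter \<Rightarrow> ('z \<Rightarrow> real) \<Rightarrow> ('z \<Rightarrow> real) \<Rightarrow> real \<Rightarrow> ('z \<Rightarrow> real) \<Rightarrow> bool" where
  "rel_first_order F \<eta> f a g \<longleftrightarrow> g \<in> O[F](\<eta>) \<and> (\<lambda>z. f z - a * (1 + g z)) \<in> o[F](\<eta>)"

lemma tendsto_zero_imp_smallo_1: "(\<eta> \<longlongrightarrow> 0) F \<Longrightarrow> \<eta> \<in> o[F](\<lambda>_. 1 :: real)"
  by (rule smalloI_tendsto) auto

lemma bigo_of_vanishing_is_smallo_1:
  assumes "(\<eta> \<longlongrightarrow> 0) F" and "g \<in> O[F](\<eta>)"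
  shows "g \<in> o[F](\<lambda>_. 1 :: real)"
  using landau_o.big_small_trans[OF assms(2) tendsto_zero_imp_smallo_1[OF assms(1)]] .

lemma bigo_scale:
  fixes f g :: "'z \<Rightarrow> real"
  assumes "f \<in> O[F](g)"
  shows "(\<lambda>z. c * f z) \<in> O[F](g)" "(\<lambda>z. f z * c) \<in> O[F](g)"
  using assms by (simp_all add: mult.commute[of _ c])

lemma smallo_scale:
  fixes f g :: "'z \<Rightarrow> real"
  assumes "f \<in> o[F](g)"
  shows "(\<lambda>z. c * f z) \<in> o[F](g)" "(\<lambda>z. f z * c) \<in> o[F](g)"
  using assms by (simp_all add: mult.commute[of _ c])

lemma bounded_imp_bigo:
  fixes \<delta> \<eta> :: "'z \<Rightarrow> real"
  assumes "eventually (\<lambda>z. \<bar>\<delta> z\<bar> \<le> \<eta> z * e) F"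
  shows "\<delta> \<in> O[F](\<eta>)"
proof (rule bigoI[of _ "\<bar>e\<bar>"])
  show "eventually (\<lambda>z. norm (\<delta> z) \<le> \<bar>e\<bar> * norm (\<eta> z)) F"
    using assms
  proof eventually_elim
    case (elim z)
    also have "\<eta> z * e \<le> \<bar>e\<bar> * \<bar>\<eta> z\<bar>" by (metis abs_ge_self abs_mult mult.commute)
    finally show ?case by simp
  qed
qed

lemma rel_first_order_mult:
  assumes \<eta>: "(\<eta> \<longlongrightarrow> 0) F"
    and f: "rel_first_order F \<eta> f a g" and h: "rel_first_order F \<eta> h b k"
  shows "rel_first_order F \<eta> (\<lambda>z. f z * h z) (a * b) (\<lambda>z. g z + k z)"
proof -
  have g: "g \<in> O[F](\<eta>)" and k: "k \<in> O[F](\<eta>)"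
    and rf: "(\<lambda>z. f z - a * (1 + g z)) \<in> o[F](\<eta>)" and rh: "(\<lambda>z. h z - b * (1 + k z)) \<in> o[F](\<eta>)"
    using f h by (auto simp: rel_first_order_def)
  have one: "(\<lambda>z. c * (1 + u z)) \<in> O[F](\<lambda>_. 1)" if "u \<in> O[F](\<eta>)" for u c
  proof -
    have "u \<in> O[F](\<lambda>_. 1)"
      using bigo_of_vanishing_is_smallo_1[OF \<eta> that] by (rule landau_o.small_imp_big)
    then have "(\<lambda>z. 1 + u z) \<in> O[F](\<lambda>_. 1)" by (intro sum_in_bigo) auto
    then show ?thesis by simp
  qed
  have "(\<lambda>z. h z - b * (1 + k z)) \<in> O[F](\<lambda>_. 1)"
    using landau_o.small_trans[OF rh tendsto_zero_imp_smallo_1[OF \<eta>]] by (rule landau_o.small_imp_big)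
  then have "(\<lambda>z. (h z - b * (1 + k z)) + b * (1 + k z)) \<in> O[F](\<lambda>_. 1)"
    using one[OF k] by (rule sum_in_bigo)
  then have h1: "h \<in> O[F](\<lambda>_. 1)" by simp
  have t1: "(\<lambda>z. (f z - a * (1 + g z)) * h z) \<in> o[F](\<eta>)"
    using landau_o.small_1_mult[OF rf h1] .
  have t2: "(\<lambda>z. a * (1 + g z) * (h z - b * (1 + k z))) \<in> o[F](\<eta>)"
    using landau_o.small_1_mult[OF rh one[OF g, of a]] by (simp only: mult.commute)
  have "(\<lambda>z. g z * k z) \<in> o[F](\<eta>)"
    using landau_o.small_1_mult''[OF g bigo_of_vanishing_is_smallo_1[OF \<eta> k]] .
  then have t3: "(\<lambda>z. a * b * (g z * k z)) \<in> o[F](\<eta>)" by simp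
  have "(\<lambda>z. (f z - a * (1 + g z)) * h z + a * (1 + g z) * (h z - b * (1 + k z))
            + a * b * (g z * k z)) \<in> o[F](\<eta>)"
    using sum_in_smallo(1)[OF sum_in_smallo(1)[OF t1 t2] t3] .
  also have "(\<lambda>z. (f z - a * (1 + g z)) * h z + a * (1 + g z) * (h z - b * (1 + k z))
            + a * b * (g z * k z)) = (\<lambda>z. f z * h z - a * b * (1 + (g z + k z)))"
    by (auto simp: algebra_simps)
  finally show ?thesis
    using sum_in_bigo(1)[OF g k] by (simp add: rel_first_order_def)
qed

lemma rel_first_order_prod:
  assumes \<eta>: "(\<eta> \<longlongrightarrow> 0) F" and "finite K"
    and "\<And>k. k \<in> K \<Longrightarrow> rel_first_order F \<eta> (f k) (a k) (g k)"
  shows "rel_first_order F \<eta> (\<lambda>z. \<Prod>k\<in>K. f k z) (\<Prod>k\<in>K. a k) (\<lambda>z. \<Sum>k\<in>K. g k z)"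
  using assms(2,3)
proof (induction K rule: finite_induct)
  case empty
  then show ?case by (simp add: rel_first_order_def)
next
  case (insert k K)
  then show ?case using rel_first_order_mult[OF \<eta>] by simp
qed

text \<open>
  For \<open>x \<noteq> 0\<close> the differential \<open>\<phi>'(x) \<delta>\<close> equals \<open>\<phi>(x) \<gamma> (\<delta> / x)\<close>.  A zero parameter is not perturbed, and the
  relative perturbation \<open>\<delta> / x = 0\<close> is then the right one as well.
\<close>
lemma rel_first_order_differentiable:
  assumes \<eta>: "(\<eta> \<longlongrightarrow> 0) F" and \<delta>: "\<delta> \<in> O[F](\<eta>)"
    and zero: "x = 0 \<Longrightarrow> eventually (\<lambda>z. \<delta> z = 0) F"
    and D: "(\<phi> has_real_derivative D) (at x)" and log: "x * D = \<phi> x * \<gamma>"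
  shows "rel_first_order F \<eta> (\<lambda>z. \<phi> (x + \<delta> z)) (\<phi> x) (\<lambda>z. \<gamma> * (\<delta> z / x))"
proof -
  obtain g where g: "\<And>y. \<phi> y - \<phi> x = g y * (y - x)" "isCont g x" "g x = D"
    using D unfolding CARAT_DERIV by blast
  have "(\<delta> \<longlongrightarrow> 0) F"
    using smalloD_tendsto[OF bigo_of_vanishing_is_smallo_1[OF \<eta> \<delta>]] by simp
  then have "((\<lambda>z. x + \<delta> z) \<longlongrightarrow> x) F" using tendsto_add[of "\<lambda>_. x" x F \<delta> 0] by simp
  then have "((\<lambda>z. g (x + \<delta> z)) \<longlongrightarrow> D) F"
    using isCont_tendsto_compose[OF g(2)] g(3) by metis
  then have "((\<lambda>z. g (x + \<delta> z) - D) \<longlongrightarrow> 0) F" by (simp add: LIM_zero)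
  then have "(\<lambda>z. \<delta> z * (g (x + \<delta> z) - D)) \<in> o[F](\<eta>)"
    by (intro landau_o.small_1_mult''[OF \<delta>] tendsto_zero_imp_smallo_1)
  moreover have "eventually (\<lambda>z. \<delta> z * (g (x + \<delta> z) - D)
      = \<phi> (x + \<delta> z) - \<phi> x * (1 + \<gamma> * (\<delta> z / x))) F"
  proof (cases "x = 0")
    case True
    show ?thesis using zero[OF True] by eventually_elim (use True in simp)
  next
    case False
    then have "D = \<phi> x * \<gamma> / x" using log by (simp add: field_simps)
    then have "\<delta> z * (g (x + \<delta> z) - D) = \<phi> (x + \<delta> z) - \<phi> x * (1 + \<gamma> * (\<delta> z / x))" for z
      using g(1)[of "x + \<delta> z"] by (simp add: algebra_simps)
    then show ?thesis by simp
  qed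
  ultimately have "(\<lambda>z. \<phi> (x + \<delta> z) - \<phi> x * (1 + \<gamma> * (\<delta> z / x))) \<in> o[F](\<eta>)"
    using landau_o.small.in_cong by fastforce
  moreover have "(\<lambda>z. \<gamma> * (\<delta> z / x)) \<in> O[F](\<eta>)"
    using \<delta> landau_o.big.cmult_in_iff[of "\<gamma> / x" \<delta> F \<eta>] by (cases "\<gamma> / x = 0") auto
  ultimately show ?thesis by (simp add: rel_first_order_def)
qed

lemma has_derivative_tangent_cos:
  "((\<lambda>x. 1 / sqrt (1 + x\<^sup>2)) has_real_derivative - x / (sqrt (1 + x\<^sup>2))^3) (at x)"
proof -
  have "1 + x\<^sup>2 > 0" by (smt (verit) zero_le_power2)
  then show ?thesis
    by (auto intro!: derivative_eq_intros simp: power3_eq_cube divide_simps)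
qed

lemma has_derivative_tangent_sin:
  "((\<lambda>x. x / sqrt (1 + x\<^sup>2)) has_real_derivative 1 / (sqrt (1 + x\<^sup>2))^3) (at x)"
proof -
  have p: "1 + x\<^sup>2 > 0" by (smt (verit) zero_le_power2)
  have q: "sqrt (1 + x\<^sup>2) * sqrt (1 + x\<^sup>2) = 1 + x\<^sup>2" using p by simp
  show ?thesis using p q
    by (auto intro!: derivative_eq_intros simp: power3_eq_cube divide_simps)
      (simp add: algebra_simps power2_eq_square)
qed

lemma rel_first_order_tangent_cos:
  assumes \<eta>: "(\<eta> \<longlongrightarrow> 0) F" and \<delta>: "\<delta> \<in> O[F](\<eta>)"
    and zero: "x = 0 \<Longrightarrow> eventually (\<lambda>z. \<delta> z = 0) F"
  shows "rel_first_order F \<eta> (\<lambda>z. 1 / sqrt (1 + (x + \<delta> z)\<^sup>2)) (1 / sqrt (1 + x\<^sup>2))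
    (\<lambda>z. - (x / sqrt (1 + x\<^sup>2))\<^sup>2 * (\<delta> z / x))"
  by (rule rel_first_order_differentiable[OF \<eta> \<delta> zero has_derivative_tangent_cos])
    (simp_all add: field_simps power2_eq_square power3_eq_cube)

lemma rel_first_order_tangent_sin:
  assumes \<eta>: "(\<eta> \<longlongrightarrow> 0) F" and \<delta>: "\<delta> \<in> O[F](\<eta>)"
    and zero: "x = 0 \<Longrightarrow> eventually (\<lambda>z. \<delta> z = 0) F"
  shows "rel_first_order F \<eta> (\<lambda>z. (x + \<delta> z) / sqrt (1 + (x + \<delta> z)\<^sup>2)) (x / sqrt (1 + x\<^sup>2))
    (\<lambda>z. (1 / sqrt (1 + x\<^sup>2))\<^sup>2 * (\<delta> z / x))"
  by (rule rel_first_order_differentiable[OF \<eta> \<delta> zero has_derivative_tangent_sin])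
    (simp_all add: field_simps power2_eq_square power3_eq_cube)

lemma rel_first_order_add:
  assumes \<eta>: "(\<eta> \<longlongrightarrow> 0) F" and \<delta>: "\<delta> \<in> O[F](\<eta>)"
    and zero: "x = 0 \<Longrightarrow> eventually (\<lambda>z. \<delta> z = 0) F"
  shows "rel_first_order F \<eta> (\<lambda>z. x + \<delta> z) x (\<lambda>z. \<delta> z / x)"
  using rel_first_order_differentiable[OF \<eta> \<delta> zero DERIV_ident, where \<gamma> = 1] by simp

text \<open>
  This covers both triangular parts of \<open>A\<close>.  The sum runs over all the tangents, also those that do not occur
  in the entry, so that it matches the sum over \<open>i\<close> of the block matrices.
\<close>
lemma rel_first_order_givens_product:
  fixes l :: "nat \<Rightarrow> real" and dl :: "'z \<Rightarrow> nat \<Rightarrow> real"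
  assumes \<eta>: "(\<eta> \<longlongrightarrow> 0) F" and ij: "1 \<le> j" "j < i" "i \<le> n"
    and dl: "\<And>k. k \<in> {2..n-1} \<Longrightarrow> (\<lambda>z. dl z k) \<in> O[F](\<eta>)"
    and l0: "\<And>k. k \<in> {2..n-1} \<Longrightarrow> l k = 0 \<Longrightarrow> eventually (\<lambda>z. dl z k = 0) F"
    and dv: "dv \<in> O[F](\<eta>)" and v0: "v = 0 \<Longrightarrow> eventually (\<lambda>z. dv z = 0) F"
  shows "rel_first_order F \<eta>
     (\<lambda>z. (if i = n then 1 else 1 / sqrt (1 + (l i + dl z i)\<^sup>2)) *
        (\<Prod>k\<in>{j<..<i}. (l k + dl z k) / sqrt (1 + (l k + dl z k)\<^sup>2)) * (v + dv z))
     ((if i = n then 1 else 1 / sqrt (1 + (l i)\<^sup>2)) * (\<Prod>k\<in>{j<..<i}. l k / sqrt (1 + (l k)\<^sup>2)) * v)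
     (\<lambda>z. dv z / v + (\<Sum>k\<in>{2..n-1}. dl z k / l k *
        (if j < k \<and> i = k then - (l k / sqrt (1 + (l k)\<^sup>2))\<^sup>2
         else if j < k \<and> k < i then (1 / sqrt (1 + (l k)\<^sup>2))\<^sup>2 else 0)))"
    (is "rel_first_order F \<eta> ?f ?a (\<lambda>z. dv z / v + (\<Sum>k\<in>{2..n-1}. ?g z k))")
proof -
  let ?c = "\<lambda>z. if i = n then 0 else - (l i / sqrt (1 + (l i)\<^sup>2))\<^sup>2 * (dl z i / l i)"
  let ?s = "\<lambda>z k. (1 / sqrt (1 + (l k)\<^sup>2))\<^sup>2 * (dl z k / l k)"
  have c: "rel_first_order F \<eta> (\<lambda>z. if i = n then 1 else 1 / sqrt (1 + (l i + dl z i)\<^sup>2))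
      (if i = n then 1 else 1 / sqrt (1 + (l i)\<^sup>2)) ?c"
  proof (cases "i = n")
    case True
    then show ?thesis by (simp add: rel_first_order_def)
  next
    case False
    then have "i \<in> {2..n-1}" using ij by auto
    then show ?thesis using rel_first_order_tangent_cos[where x = "l i", OF \<eta> dl[of i] l0[of i]] False by simp
  qed
  have s: "rel_first_order F \<eta> (\<lambda>z. \<Prod>k\<in>{j<..<i}. (l k + dl z k) / sqrt (1 + (l k + dl z k)\<^sup>2))
      (\<Prod>k\<in>{j<..<i}. l k / sqrt (1 + (l k)\<^sup>2)) (\<lambda>z. \<Sum>k\<in>{j<..<i}. ?s z k)"
  proof (rule rel_first_order_prod[OF \<eta>])
    fix k assume "k \<in> {j<..<i}"
    then have "k \<in> {2..n-1}" using ij by auto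
    then show "rel_first_order F \<eta> (\<lambda>z. (l k + dl z k) / sqrt (1 + (l k + dl z k)\<^sup>2))
        (l k / sqrt (1 + (l k)\<^sup>2)) (\<lambda>z. ?s z k)"
      by (intro rel_first_order_tangent_sin[OF \<eta> dl l0])
  qed simp
  have "?c z + (\<Sum>k\<in>{j<..<i}. ?s z k) + dv z / v = dv z / v + (\<Sum>k\<in>{2..n-1}. ?g z k)" for z
  proof -
    have "(\<Sum>k\<in>{2..n-1}. ?g z k) = (\<Sum>k\<in>{j<..<i} \<union> ({i} - {n}). ?g z k)"
      using ij by (intro sum.mono_neutral_right) auto
    also have "\<dots> = (\<Sum>k\<in>{j<..<i}. ?g z k) + (\<Sum>k\<in>{i} - {n}. ?g z k)"
      by (rule sum.union_disjoint) auto
    also have "(\<Sum>k\<in>{j<..<i}. ?g z k) = (\<Sum>k\<in>{j<..<i}. ?s z k)"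
      by (rule sum.cong) auto
    also have "(\<Sum>k\<in>{i} - {n}. ?g z k) = ?c z" using ij by simp
    finally show ?thesis by simp
  qed
  then show ?thesis
    using rel_first_order_mult[OF \<eta> rel_first_order_mult[OF \<eta> c s] rel_first_order_add[where x = v, OF \<eta> dv v0]]
    by (simp only: if_True)
qed

lemma rel_first_orderD:
  assumes "rel_first_order F \<eta> f a g"
  shows "(\<lambda>z. a * g z) \<in> O[F](\<eta>)" "(\<lambda>z. f z - a - a * g z) \<in> o[F](\<eta>)"
  using assms by (simp_all add: rel_first_order_def algebra_simps bigo_scale(1))

section \<open>The differential of a matrix in its tangent-Givens-vector parameters\<close>

text \<open>
  The entry \<open>(a, b)\<close> of the differential of \<open>gv_mat n\<close> at \<open>\<Omega>\<close> in the direction \<open>\<Delta>\<close>, counted from 0.  In the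
  column \<open>b = n - 1\<close> and the row \<open>a = n - 1\<close> the quotients refer to parameters that do not exist, but
  there the triangular factors vanish.
\<close>
definition gv_differential :: "nat \<Rightarrow> gv_params \<Rightarrow> gv_params \<Rightarrow> nat \<Rightarrow> nat \<Rightarrow> real" where
  "gv_differential n \<Omega> \<Delta> a b =
     (if a = b then gd \<Delta> (Suc a) else 0)
     + strict_lower (gv_mat n \<Omega>) $$ (a, b) * (gv \<Delta> (Suc b) / gv \<Omega> (Suc b))
     + gw \<Delta> (Suc a) / gw \<Omega> (Suc a) * strict_upper (gv_mat n \<Omega>) $$ (a, b)
     + (\<Sum>i\<in>{2..n-1}. gl \<Delta> i / gl \<Omega> i * lower_block n \<Omega> (gv_mat n \<Omega>) i $$ (a, b))
     + (\<Sum>i\<in>{2..n-1}. gu \<Delta> i / gu \<Omega> i * upper_block n \<Omega> (gv_mat n \<Omega>) i $$ (a, b))"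

lemma gv_mat_first_order:
  assumes \<eta>: "(\<eta> \<longlongrightarrow> 0) F" and ok: "gv_quotients_ok n \<Omega> E"
    and bd: "eventually (\<lambda>z. gv_bounded n (\<eta> z) E (\<Delta> z)) F"
    and ab: "a < n" "b < n"
  shows "(\<lambda>z. gv_differential n \<Omega> (\<Delta> z) a b) \<in> O[F](\<eta>)"
    and "(\<lambda>z. gv_mat n (gv_add \<Omega> (\<Delta> z)) $$ (a, b) - gv_mat n \<Omega> $$ (a, b)
            - gv_differential n \<Omega> (\<Delta> z) a b) \<in> o[F](\<eta>)"
proof -
  have ev: "eventually (\<lambda>z. \<bar>gl (\<Delta> z) i\<bar> \<le> \<eta> z * gl E i) F"
      "eventually (\<lambda>z. \<bar>gu (\<Delta> z) i\<bar> \<le> \<eta> z * gu E i) F" if "i \<in> {2..n-1}" for i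
    using bd by (rule eventually_mono; use that in \<open>simp add: gv_bounded_def\<close>)+
  have ev': "eventually (\<lambda>z. \<bar>gv (\<Delta> z) i\<bar> \<le> \<eta> z * gv E i) F"
      "eventually (\<lambda>z. \<bar>gw (\<Delta> z) i\<bar> \<le> \<eta> z * gw E i) F" if "i \<in> {1..n-1}" for i
    using bd by (rule eventually_mono; use that in \<open>simp add: gv_bounded_def\<close>)+
  have evd: "eventually (\<lambda>z. \<bar>gd (\<Delta> z) i\<bar> \<le> \<eta> z * gd E i) F" if "i \<in> {1..n}" for i
    using bd by (rule eventually_mono; use that in \<open>simp add: gv_bounded_def\<close>)+
  have zero: "eventually (\<lambda>z. gl (\<Delta> z) i = 0) F" if "i \<in> {2..n-1}" "gl \<Omega> i = 0" for i
    using ev(1)[OF that(1)] by (rule eventually_mono) (use ok that in \<open>simp add: gv_quotients_ok_def\<close>)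
  have zeru: "eventually (\<lambda>z. gu (\<Delta> z) i = 0) F" if "i \<in> {2..n-1}" "gu \<Omega> i = 0" for i
    using ev(2)[OF that(1)] by (rule eventually_mono) (use ok that in \<open>simp add: gv_quotients_ok_def\<close>)
  have zerv: "eventually (\<lambda>z. gv (\<Delta> z) i = 0) F" if "i \<in> {1..n-1}" "gv \<Omega> i = 0" for i
    using ev'(1)[OF that(1)] by (rule eventually_mono) (use ok that in \<open>simp add: gv_quotients_ok_def\<close>)
  have zerw: "eventually (\<lambda>z. gw (\<Delta> z) i = 0) F" if "i \<in> {1..n-1}" "gw \<Omega> i = 0" for i
    using ev'(2)[OF that(1)] by (rule eventually_mono) (use ok that in \<open>simp add: gv_quotients_ok_def\<close>)
  let ?D = "\<lambda>z. gv_differential n \<Omega> (\<Delta> z) a b"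
  have "?D \<in> O[F](\<eta>) \<and> (\<lambda>z. gv_mat n (gv_add \<Omega> (\<Delta> z)) $$ (a, b) - gv_mat n \<Omega> $$ (a, b) - ?D z) \<in> o[F](\<eta>)"
  proof (cases rule: linorder_cases[of a b])
    case equal
    have "?D = (\<lambda>z. gd (\<Delta> z) (Suc a))"
      using ab equal by (auto simp: gv_differential_def strict_lower_def strict_upper_def gv_mat_def
          lower_block_def upper_block_def intro!: sum.neutral)
    moreover have "(\<lambda>z. gv_mat n (gv_add \<Omega> (\<Delta> z)) $$ (a, b) - gv_mat n \<Omega> $$ (a, b)) = (\<lambda>z. gd (\<Delta> z) (Suc a))"
      using ab equal by (simp add: gv_mat_def gv_entry_def gv_add_def)
    ultimately show ?thesis
      using bounded_imp_bigo[OF evd, of "Suc a"] ab by (simp add: fun_eq_iff)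
  next
    case greater
    let ?g = "\<lambda>z. gv (\<Delta> z) (Suc b) / gv \<Omega> (Suc b) + (\<Sum>k\<in>{2..n-1}. gl (\<Delta> z) k / gl \<Omega> k *
        (if Suc b < k \<and> Suc a = k then - (gl \<Omega> k / sqrt (1 + (gl \<Omega> k)\<^sup>2))\<^sup>2
         else if Suc b < k \<and> k < Suc a then (1 / sqrt (1 + (gl \<Omega> k)\<^sup>2))\<^sup>2 else 0))"
    have "rel_first_order F \<eta> (\<lambda>z. gv_mat n (gv_add \<Omega> (\<Delta> z)) $$ (a, b)) (gv_mat n \<Omega> $$ (a, b)) ?g"
    proof -
      have entry: "gv_mat n \<Omega>' $$ (a, b) = (if Suc a = n then 1 else 1 / sqrt (1 + (gl \<Omega>' (Suc a))\<^sup>2)) *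
        (\<Prod>k\<in>{Suc b<..<Suc a}. gl \<Omega>' k / sqrt (1 + (gl \<Omega>' k)\<^sup>2)) * gv \<Omega>' (Suc b)" for \<Omega>'
        using greater ab by (simp add: gv_mat_def gv_entry_def gv_c_def gv_s_def)
      have add: "gl (gv_add \<Omega> \<Delta>') i = gl \<Omega> i + gl \<Delta>' i" "gv (gv_add \<Omega> \<Delta>') i = gv \<Omega> i + gv \<Delta>' i" for \<Delta>' i
        by (simp_all add: gv_add_def)
      show ?thesis
        unfolding entry add
      proof (rule rel_first_order_givens_product[OF \<eta>])
        show "1 \<le> Suc b" "Suc b < Suc a" "Suc a \<le> n" using greater ab by auto
      qed (use greater ab in \<open>simp_all add: bounded_imp_bigo[OF ev(1)] bounded_imp_bigo[OF ev'(1)] zero zerv\<close>)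
    qed
    note rel = rel_first_orderD[OF this]
    have D: "?D z = gv_mat n \<Omega> $$ (a, b) * ?g z" for z
    proof -
      have "(\<Sum>i\<in>{2..n-1}. gu (\<Delta> z) i / gu \<Omega> i * upper_block n \<Omega> (gv_mat n \<Omega>) i $$ (a, b)) = 0"
        using ab greater by (intro sum.neutral) (auto simp: upper_block_def)
      moreover have "(\<Sum>i\<in>{2..n-1}. gl (\<Delta> z) i / gl \<Omega> i * lower_block n \<Omega> (gv_mat n \<Omega>) i $$ (a, b))
        = gv_mat n \<Omega> $$ (a, b) * (\<Sum>k\<in>{2..n-1}. gl (\<Delta> z) k / gl \<Omega> k *
        (if Suc b < k \<and> Suc a = k then - (gl \<Omega> k / sqrt (1 + (gl \<Omega> k)\<^sup>2))\<^sup>2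
         else if Suc b < k \<and> k < Suc a then (1 / sqrt (1 + (gl \<Omega> k)\<^sup>2))\<^sup>2 else 0))"
        unfolding sum_distrib_left using ab greater
        by (intro sum.cong refl) (auto simp: lower_block_def gv_c_def gv_s_def)
      ultimately show "?D z = gv_mat n \<Omega> $$ (a, b) * ?g z"
        using ab greater by (simp add: gv_differential_def strict_lower_def strict_upper_def gv_mat_def distrib_left)
    qed
    show ?thesis unfolding D by (rule conjI[OF rel])
  next
    case less
    let ?g = "\<lambda>z. gw (\<Delta> z) (Suc a) / gw \<Omega> (Suc a) + (\<Sum>k\<in>{2..n-1}. gu (\<Delta> z) k / gu \<Omega> k *
        (if Suc a < k \<and> Suc b = k then - (gu \<Omega> k / sqrt (1 + (gu \<Omega> k)\<^sup>2))\<^sup>2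
         else if Suc a < k \<and> k < Suc b then (1 / sqrt (1 + (gu \<Omega> k)\<^sup>2))\<^sup>2 else 0))"
    have "rel_first_order F \<eta> (\<lambda>z. gv_mat n (gv_add \<Omega> (\<Delta> z)) $$ (a, b)) (gv_mat n \<Omega> $$ (a, b)) ?g"
    proof -
      have entry: "gv_mat n \<Omega>' $$ (a, b) = (if Suc b = n then 1 else 1 / sqrt (1 + (gu \<Omega>' (Suc b))\<^sup>2)) *
        (\<Prod>k\<in>{Suc a<..<Suc b}. gu \<Omega>' k / sqrt (1 + (gu \<Omega>' k)\<^sup>2)) * gw \<Omega>' (Suc a)" for \<Omega>'
        using less ab by (simp add: gv_mat_def gv_entry_def gv_r_def gv_t_def)
      have add: "gu (gv_add \<Omega> \<Delta>') i = gu \<Omega> i + gu \<Delta>' i" "gw (gv_add \<Omega> \<Delta>') i = gw \<Omega> i + gw \<Delta>' i" for \<Delta>' i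
        by (simp_all add: gv_add_def)
      show ?thesis
        unfolding entry add
      proof (rule rel_first_order_givens_product[OF \<eta>])
        show "1 \<le> Suc a" "Suc a < Suc b" "Suc b \<le> n" using less ab by auto
      qed (use less ab in \<open>simp_all add: bounded_imp_bigo[OF ev(2)] bounded_imp_bigo[OF ev'(2)] zeru zerw\<close>)
    qed
    note rel = rel_first_orderD[OF this]
    have D: "?D z = gv_mat n \<Omega> $$ (a, b) * ?g z" for z
    proof -
      have "(\<Sum>i\<in>{2..n-1}. gl (\<Delta> z) i / gl \<Omega> i * lower_block n \<Omega> (gv_mat n \<Omega>) i $$ (a, b)) = 0"
        using ab less by (intro sum.neutral) (auto simp: lower_block_def)
      moreover have "(\<Sum>i\<in>{2..n-1}. gu (\<Delta> z) i / gu \<Omega> i * upper_block n \<Omega> (gv_mat n \<Omega>) i $$ (a, b))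
        = gv_mat n \<Omega> $$ (a, b) * (\<Sum>k\<in>{2..n-1}. gu (\<Delta> z) k / gu \<Omega> k *
        (if Suc a < k \<and> Suc b = k then - (gu \<Omega> k / sqrt (1 + (gu \<Omega> k)\<^sup>2))\<^sup>2
         else if Suc a < k \<and> k < Suc b then (1 / sqrt (1 + (gu \<Omega> k)\<^sup>2))\<^sup>2 else 0))"
        unfolding sum_distrib_left using ab less
        by (intro sum.cong refl) (auto simp: upper_block_def gv_r_def gv_t_def)
      ultimately show "?D z = gv_mat n \<Omega> $$ (a, b) * ?g z"
        using ab less by (simp add: gv_differential_def strict_lower_def strict_upper_def gv_mat_def distrib_left)
    qed
    show ?thesis unfolding D by (rule conjI[OF rel])
  qed
  then show "?D \<in> O[F](\<eta>)"
    and "(\<lambda>z. gv_mat n (gv_add \<Omega> (\<Delta> z)) $$ (a, b) - gv_mat n \<Omega> $$ (a, b) - ?D z) \<in> o[F](\<eta>)"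
    by auto
qed

section \<open>Perturbed linear systems\<close>

lemma abs_le_max_norm:
  assumes "Z \<in> carrier_mat n m" "p < n" "q < m"
  shows "\<bar>Z $$ (p, q)\<bar> \<le> max_norm Z"
proof -
  have "finite (elements_mat Z)" by (auto simp: elements_mat_def)
  moreover have "Z $$ (p, q) \<in> elements_mat Z" using assms by auto
  ultimately show ?thesis unfolding max_norm_def by (intro Max_ge) auto
qed

lemma max_norm_attained:
  assumes "Z \<in> carrier_mat n m" "0 < n" "0 < m"
  obtains p q where "p < n" "q < m" "max_norm Z = \<bar>Z $$ (p, q)\<bar>"
proof -
  have "finite (elements_mat Z)" by (auto simp: elements_mat_def)
  moreover have "Z $$ (0, 0) \<in> elements_mat Z" using assms by auto
  ultimately have "max_norm Z \<in> abs ` elements_mat Z" unfolding max_norm_def by (intro Max_in) auto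
  then show ?thesis using that assms(1) by (auto simp: elements_mat_def)
qed

lemma mat_mult_entry:
  assumes "A \<in> carrier_mat n k" "C \<in> carrier_mat k m" "p < n" "q < m"
  shows "(A * C) $$ (p, q) = (\<Sum>b<k. A $$ (p, b) * C $$ (b, q))"
  using assms by (auto simp: scalar_prod_def lessThan_atLeast0)

text \<open>
  The solution \<open>DX\<close> is a fixed point of an affine map whose linear part tends to 0, which first yields
  \<open>DX = O(\<eta>)\<close>; the linear part applied to \<open>DX\<close> is then \<open>o(\<eta>)\<close>.  The filter is arbitrary: a
  filter on all perturbations gives a uniform estimate, and a filter on step sizes gives one along a curve.
\<close>
lemma perturbed_solution_first_order:
  fixes A Ai B X :: "real mat" and A' B' DX :: "'z \<Rightarrow> real mat"
  assumes \<eta>: "(\<eta> \<longlongrightarrow> 0) F"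
    and A: "A \<in> carrier_mat n n" and Ai: "Ai \<in> carrier_mat n n" and inv: "Ai * A = 1\<^sub>m n"
    and X: "X \<in> carrier_mat n m" and B: "B \<in> carrier_mat n m" and AX: "A * X = B"
    and carr: "\<And>z. A' z \<in> carrier_mat n n" "\<And>z. B' z \<in> carrier_mat n m"
    and sol: "eventually (\<lambda>z. DX z \<in> carrier_mat n m \<and> A' z * (X + DX z) = B' z) F"
    and dA: "\<And>a b. a < n \<Longrightarrow> b < n \<Longrightarrow> (\<lambda>z. dA z a b) \<in> O[F](\<eta>)"
    and rA: "\<And>a b. a < n \<Longrightarrow> b < n \<Longrightarrow>
      (\<lambda>z. A' z $$ (a, b) - A $$ (a, b) - dA z a b) \<in> o[F](\<eta>)"
    and dB: "\<And>a q. a < n \<Longrightarrow> q < m \<Longrightarrow> (\<lambda>z. dB z a q) \<in> O[F](\<eta>)"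
    and rB: "\<And>a q. a < n \<Longrightarrow> q < m \<Longrightarrow>
      (\<lambda>z. B' z $$ (a, q) - B $$ (a, q) - dB z a q) \<in> o[F](\<eta>)"
    and pq: "p < n" "q < m"
  shows "(\<lambda>z. DX z $$ (p, q) -
    (\<Sum>a<n. Ai $$ (p, a) * (dB z a q - (\<Sum>b<n. dA z a b * X $$ (b, q))))) \<in> o[F](\<eta>)"
proof -
  define EA where "EA z a b = A' z $$ (a, b) - A $$ (a, b)" for z a b
  define EB where "EB z a q = B' z $$ (a, q) - B $$ (a, q)" for z a q
  define u where "u p q z = (\<Sum>a<n. Ai $$ (p, a) * (EB z a q - (\<Sum>b<n. EA z a b * X $$ (b, q))))" for p q z
  define k where "k p b z = - (\<Sum>a<n. Ai $$ (p, a) * EA z a b)" for p b z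
  have EA: "(\<lambda>z. EA z a b) \<in> O[F](\<eta>)" if "a < n" "b < n" for a b
    using sum_in_bigo(1)[OF landau_o.small_imp_big[OF rA[OF that]] dA[OF that]] by (simp add: EA_def)
  have EB: "(\<lambda>z. EB z a q) \<in> O[F](\<eta>)" if "a < n" "q < m" for a q
    using sum_in_bigo(1)[OF landau_o.small_imp_big[OF rB[OF that]] dB[OF that]] by (simp add: EB_def)
  have u: "u p q \<in> O[F](\<eta>)" if "q < m" for p q
    unfolding u_def using that EA EB
    by (intro big_sum_in_bigo bigo_scale sum_in_bigo) auto
  have k: "k p b \<in> o[F](\<lambda>_. 1)" if "b < n" for p b
  proof -
    have "(\<lambda>z. Ai $$ (p, a) * EA z a b) \<in> o[F](\<lambda>_. 1)" if "a < n" for a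
      using bigo_of_vanishing_is_smallo_1[OF \<eta> EA[OF that \<open>b < n\<close>]] by simp
    then have "(\<lambda>z. \<Sum>a<n. Ai $$ (p, a) * EA z a b) \<in> o[F](\<lambda>_. 1)"
      by (intro big_sum_in_smallo) auto
    then show ?thesis unfolding k_def by simp
  qed
  have fix_eq: "DX z $$ (p, q) = u p q z + (\<Sum>b<n. k p b z * DX z $$ (b, q))"
    if DX: "DX z \<in> carrier_mat n m" and eq: "A' z * (X + DX z) = B' z" and pq: "p < n" "q < m" for z p q
  proof -
    have "(A * DX z) $$ (a, q) = EB z a q - (\<Sum>b<n. EA z a b * X $$ (b, q)) - (\<Sum>b<n. EA z a b * DX z $$ (b, q))"
      if a: "a < n" for a
    proof -
      have "B' z $$ (a, q) = (\<Sum>b<n. A' z $$ (a, b) * (X + DX z) $$ (b, q))"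
        unfolding eq[symmetric] using mat_mult_entry[OF carr(1) _ a pq(2)] X DX by simp
      also have "\<dots> = (\<Sum>b<n. (A $$ (a, b) + EA z a b) * (X $$ (b, q) + DX z $$ (b, q)))"
        using X DX pq by (intro sum.cong) (auto simp: EA_def)
      also have "\<dots> = (\<Sum>b<n. A $$ (a, b) * X $$ (b, q)) + (\<Sum>b<n. A $$ (a, b) * DX z $$ (b, q))
          + (\<Sum>b<n. EA z a b * X $$ (b, q)) + (\<Sum>b<n. EA z a b * DX z $$ (b, q))"
        by (simp add: algebra_simps sum.distrib)
      also have "(\<Sum>b<n. A $$ (a, b) * X $$ (b, q)) = B $$ (a, q)"
        unfolding AX[symmetric] using mat_mult_entry[OF A X a pq(2)] by simp
      also have "(\<Sum>b<n. A $$ (a, b) * DX z $$ (b, q)) = (A * DX z) $$ (a, q)"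
        using mat_mult_entry[OF A DX a pq(2)] by simp
      finally show ?thesis by (simp add: EB_def)
    qed note residual = this
    have "DX z = Ai * (A * DX z)"
      unfolding assoc_mult_mat[OF Ai A DX, symmetric] inv left_mult_one_mat[OF DX] ..
    then have "DX z $$ (p, q) = (\<Sum>a<n. Ai $$ (p, a) * (A * DX z) $$ (a, q))"
      using mat_mult_entry[OF Ai mult_carrier_mat[OF A DX] pq] by simp
    also have "\<dots> = (\<Sum>a<n. Ai $$ (p, a) * (EB z a q - (\<Sum>b<n. EA z a b * X $$ (b, q)))
        - (\<Sum>b<n. Ai $$ (p, a) * EA z a b * DX z $$ (b, q)))"
      by (intro sum.cong) (auto simp: residual right_diff_distrib sum_distrib_left mult.assoc)
    also have "\<dots> = u p q z - (\<Sum>a<n. \<Sum>b<n. Ai $$ (p, a) * EA z a b * DX z $$ (b, q))"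
      by (simp add: u_def sum_subtractf)
    also have "(\<Sum>a<n. \<Sum>b<n. Ai $$ (p, a) * EA z a b * DX z $$ (b, q)) = - (\<Sum>b<n. k p b z * DX z $$ (b, q))"
      by (subst sum.swap) (simp add: k_def sum_distrib_right sum_negf)
    finally show ?thesis by simp
  qed
  \<comment> \<open>The sum \<open>s\<close> of all entries of \<open>\<bar>DX\<bar>\<close> satisfies \<open>s \<le> U + \<kappa> s\<close>, where \<open>U = O(\<eta>)\<close> and \<open>\<kappa> \<rightarrow> 0\<close>.\<close>
  define s where "s z = (\<Sum>p<n. \<Sum>q<m. \<bar>DX z $$ (p, q)\<bar>)" for z
  define U where "U z = (\<Sum>p<n. \<Sum>q<m. \<bar>u p q z\<bar>)" for z
  define \<kappa> where "\<kappa> z = (\<Sum>p<n. \<Sum>q<m. \<Sum>b<n. \<bar>k p b z\<bar>)" for z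
  have U: "U \<in> O[F](\<eta>)"
    unfolding U_def by (intro big_sum_in_bigo) (use u in auto)
  have "\<kappa> \<in> o[F](\<lambda>_. 1)"
    unfolding \<kappa>_def by (intro big_sum_in_smallo) (use k in auto)
  then have small: "eventually (\<lambda>z. \<bar>\<kappa> z\<bar> \<le> 1 / 2) F"
    using landau_o.smallD[of \<kappa> F "\<lambda>_. 1" "1/2"] by simp
  have entry_le: "\<bar>DX z $$ (p, q)\<bar> \<le> s z" if "p < n" "q < m" for p q z
  proof -
    have "\<bar>DX z $$ (p, q)\<bar> \<le> (\<Sum>q<m. \<bar>DX z $$ (p, q)\<bar>)"
      using that by (intro member_le_sum[of q "{..<m}" "\<lambda>q. \<bar>DX z $$ (p, q)\<bar>"]) auto
    also have "\<dots> \<le> s z" unfolding s_def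
      using that by (intro member_le_sum[of p "{..<n}" "\<lambda>p. \<Sum>q<m. \<bar>DX z $$ (p, q)\<bar>"]) (auto intro: sum_nonneg)
    finally show ?thesis .
  qed
  have s_le: "eventually (\<lambda>z. s z \<le> 2 * U z) F"
    using sol small
  proof eventually_elim
    case (elim z)
    have "\<bar>DX z $$ (p, q)\<bar> \<le> \<bar>u p q z\<bar> + (\<Sum>b<n. \<bar>k p b z\<bar>) * s z" if pq: "p < n" "q < m" for p q
    proof -
      have "\<bar>\<Sum>b<n. k p b z * DX z $$ (b, q)\<bar> \<le> (\<Sum>b<n. \<bar>k p b z\<bar> * s z)"
        using entry_le pq by (intro order_trans[OF sum_abs] sum_mono) (auto simp: abs_mult intro!: mult_left_mono)
      then show ?thesis
        using fix_eq[of z p q] elim(1) pq by (simp add: sum_distrib_right)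
    qed
    then have "s z \<le> (\<Sum>p<n. \<Sum>q<m. \<bar>u p q z\<bar> + (\<Sum>b<n. \<bar>k p b z\<bar>) * s z)"
      unfolding s_def[of z] by (intro sum_mono) (auto simp: s_def)
    also have "\<dots> = U z + \<kappa> z * s z"
      by (simp add: U_def \<kappa>_def sum.distrib sum_distrib_right mult.assoc)
    also have "\<kappa> z * s z \<le> 1 / 2 * s z"
      using elim(2) by (intro mult_right_mono) (auto simp: s_def intro!: sum_nonneg)
    finally show ?case by simp
  qed
  have DXO: "(\<lambda>z. DX z $$ (p, q)) \<in> O[F](\<eta>)" if "p < n" "q < m" for p q
  proof -
    have "(\<lambda>z. DX z $$ (p, q)) \<in> O[F](U)"
    proof (rule bigoI[of _ 2])
      show "eventually (\<lambda>z. norm (DX z $$ (p, q)) \<le> 2 * norm (U z)) F"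
        using s_le
      proof eventually_elim
        case (elim z)
        then show ?case using entry_le[OF that, of z] by simp
      qed
    qed
    then show ?thesis by (rule landau_o.big_trans[OF _ U])
  qed
  have "(\<lambda>z. k p b z * DX z $$ (b, q)) \<in> o[F](\<eta>)" if "b < n" for b
    using landau_o.small_1_mult''[OF DXO k] that pq by (simp add: mult.commute)
  then have second: "(\<lambda>z. \<Sum>b<n. k p b z * DX z $$ (b, q)) \<in> o[F](\<eta>)"
    by (intro big_sum_in_smallo) auto
  have first: "(\<lambda>z. u p q z - (\<Sum>a<n. Ai $$ (p, a) * (dB z a q - (\<Sum>b<n. dA z a b * X $$ (b, q))))) \<in> o[F](\<eta>)"
  proof -
    have "(\<lambda>z. Ai $$ (p, a) * ((EB z a q - dB z a q) - (\<Sum>b<n. (EA z a b - dA z a b) * X $$ (b, q)))) \<in> o[F](\<eta>)"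
      if "a < n" for a
    proof -
      have "(\<lambda>z. \<Sum>b<n. (EA z a b - dA z a b) * X $$ (b, q)) \<in> o[F](\<eta>)"
        unfolding EA_def using that rA by (intro big_sum_in_smallo smallo_scale(2)) auto
      moreover have "(\<lambda>z. EB z a q - dB z a q) \<in> o[F](\<eta>)"
        unfolding EB_def using that rB pq by auto
      ultimately show ?thesis using smallo_scale(1)[OF sum_in_smallo(2)] by blast
    qed
    then have "(\<lambda>z. \<Sum>a<n. Ai $$ (p, a) * ((EB z a q - dB z a q) - (\<Sum>b<n. (EA z a b - dA z a b) * X $$ (b, q)))) \<in> o[F](\<eta>)"
      by (intro big_sum_in_smallo) auto
    also have "(\<lambda>z. \<Sum>a<n. Ai $$ (p, a) * ((EB z a q - dB z a q) - (\<Sum>b<n. (EA z a b - dA z a b) * X $$ (b, q))))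
      = (\<lambda>z. u p q z - (\<Sum>a<n. Ai $$ (p, a) * (dB z a q - (\<Sum>b<n. dA z a b * X $$ (b, q)))))"
    proof
      fix z
      have "Ai $$ (p, a) * ((EB z a q - dB z a q) - (\<Sum>b<n. (EA z a b - dA z a b) * X $$ (b, q)))
        = Ai $$ (p, a) * (EB z a q - (\<Sum>b<n. EA z a b * X $$ (b, q)))
          - Ai $$ (p, a) * (dB z a q - (\<Sum>b<n. dA z a b * X $$ (b, q)))" for a
        by (simp add: left_diff_distrib right_diff_distrib sum_subtractf)
      then show "(\<Sum>a<n. Ai $$ (p, a) * ((EB z a q - dB z a q) - (\<Sum>b<n. (EA z a b - dA z a b) * X $$ (b, q))))
        = u p q z - (\<Sum>a<n. Ai $$ (p, a) * (dB z a q - (\<Sum>b<n. dA z a b * X $$ (b, q))))"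
        unfolding u_def by (simp add: sum_subtractf)
    qed
    finally show ?thesis .
  qed
  have "eventually (\<lambda>z. (u p q z - (\<Sum>a<n. Ai $$ (p, a) * (dB z a q - (\<Sum>b<n. dA z a b * X $$ (b, q)))))
      + (\<Sum>b<n. k p b z * DX z $$ (b, q))
      = DX z $$ (p, q) - (\<Sum>a<n. Ai $$ (p, a) * (dB z a q - (\<Sum>b<n. dA z a b * X $$ (b, q))))) F"
    using sol
  proof eventually_elim
    case (elim z)
    then have "DX z $$ (p, q) = u p q z + (\<Sum>b<n. k p b z * DX z $$ (b, q))"
      using pq by (intro fix_eq) auto
    then show ?case by linarith
  qed
  from landau_o.small.in_cong[OF this] sum_in_smallo(1)[OF first second] show ?thesis
    by (rule iffD1)
qed

text \<open>
  The determinant is continuous in the entries, so the perturbed matrices are eventually nonsingular.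
\<close>
lemma perturbed_system_solvable:
  fixes A X :: "real mat" and A' B' :: "'z \<Rightarrow> real mat"
  assumes A: "A \<in> carrier_mat n n" and Ai: "Ai \<in> carrier_mat n n" and inv: "Ai * A = 1\<^sub>m n"
    and carr: "\<And>z. A' z \<in> carrier_mat n n" "\<And>z. B' z \<in> carrier_mat n m" and X: "X \<in> carrier_mat n m"
    and lim: "\<And>a b. a < n \<Longrightarrow> b < n \<Longrightarrow> ((\<lambda>z. A' z $$ (a, b)) \<longlongrightarrow> A $$ (a, b)) F"
  shows "eventually (\<lambda>z. \<exists>D\<in>carrier_mat n m. A' z * (X + D) = B' z) F"
proof -
  have "det A \<noteq> 0" using det_mult[OF Ai A] inv by auto
  have "((\<lambda>z. det (A' z)) \<longlongrightarrow> det A) F"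
    unfolding det_def'[OF A] det_def'[OF carr(1)]
    by (intro tendsto_sum tendsto_mult tendsto_prod tendsto_const lim)
      (auto simp: permutes_in_image)
  then have "eventually (\<lambda>z. det (A' z) \<noteq> 0) F"
    using \<open>det A \<noteq> 0\<close> by (rule tendsto_imp_eventually_ne)
  then show ?thesis
  proof eventually_elim
    case (elim z)
    then have "A' z \<in> Units (ring_mat TYPE(real) n ())"
      by (rule det_non_zero_imp_unit[OF carr(1)])
    then obtain C where "mat_inverse (A' z) = Some C"
      using mat_inverse(1)[OF carr(1)] by (metis not_None_eq)
    then have C: "C \<in> carrier_mat n n" "A' z * C = 1\<^sub>m n"
      using mat_inverse(2)[OF carr(1)] by auto
    have "A' z * (X + (C * B' z - X)) = B' z"
    proof -
      have "X + (C * B' z - X) = C * B' z" using X C carr(2)[of z] by (intro eq_matI) auto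
      then have "A' z * (X + (C * B' z - X)) = A' z * (C * B' z)" by simp
      also have "A' z * (C * B' z) = A' z * C * B' z"
        using assoc_mult_mat[OF carr(1) C(1) carr(2)] by simp
      also have "\<dots> = B' z" using C(2) left_mult_one_mat[OF carr(2)] by simp
      finally show ?thesis .
    qed
    moreover have "C * B' z - X \<in> carrier_mat n m" using X by auto
    ultimately show ?case by blast
  qed
qed

section \<open>The linear form of an entry of the solution\<close>

text \<open>
  The coefficients \<open>cB\<close>, \<open>cD\<close>, \<open>cV\<close>, \<open>cW\<close>, \<open>cL\<close>, \<open>cU\<close> belong to the perturbations of \<open>B\<close> and of the five
  parameter families.  Those of \<open>B\<close> and of the diagonal multiply absolute perturbations, the others relative ones.
\<close>
definition gv_form ::
  "nat \<Rightarrow> nat \<Rightarrow> gv_params \<Rightarrow> (nat \<Rightarrow> real) \<Rightarrow> (nat \<Rightarrow> real) \<Rightarrow> (nat \<Rightarrow> real) \<Rightarrow> (nat \<Rightarrow> real) \<Rightarrow>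
   (nat \<Rightarrow> real) \<Rightarrow> (nat \<Rightarrow> real) \<Rightarrow> gv_params \<Rightarrow> (nat \<Rightarrow> real) \<Rightarrow> real" where
  "gv_form n M \<Omega> cB cD cV cW cL cU \<Delta> \<delta> =
     (\<Sum>k\<in>{1..M}. \<delta> k * cB k)
     - (\<Sum>j<n. gd \<Delta> (Suc j) * cD j)
     - (\<Sum>j<n-1. gv \<Delta> (Suc j) / gv \<Omega> (Suc j) * cV j)
     - (\<Sum>j<n-1. gw \<Delta> (Suc j) / gw \<Omega> (Suc j) * cW j)
     - (\<Sum>i\<in>{2..n-1}. gl \<Delta> i / gl \<Omega> i * cL i)
     - (\<Sum>i\<in>{2..n-1}. gu \<Delta> i / gu \<Omega> i * cU i)"

text \<open>
  For nonnegative weights \<open>E\<close>, \<open>f\<close> whose quotients respect the convention for zero parameters, this is the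
  largest value of \<open>gv_form\<close> over the box of perturbations bounded by them.
\<close>
definition gv_weight ::
  "nat \<Rightarrow> nat \<Rightarrow> gv_params \<Rightarrow> (nat \<Rightarrow> real) \<Rightarrow> (nat \<Rightarrow> real) \<Rightarrow> (nat \<Rightarrow> real) \<Rightarrow> (nat \<Rightarrow> real) \<Rightarrow>
   (nat \<Rightarrow> real) \<Rightarrow> (nat \<Rightarrow> real) \<Rightarrow> gv_params \<Rightarrow> (nat \<Rightarrow> real) \<Rightarrow> real" where
  "gv_weight n M \<Omega> cB cD cV cW cL cU E f =
     (\<Sum>k\<in>{1..M}. f k * \<bar>cB k\<bar>)
     + (\<Sum>j<n. \<bar>gd E (Suc j)\<bar> * \<bar>cD j\<bar>)
     + (\<Sum>j<n-1. \<bar>gv E (Suc j) / gv \<Omega> (Suc j)\<bar> * \<bar>cV j\<bar>)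
     + (\<Sum>j<n-1. \<bar>gw E (Suc j) / gw \<Omega> (Suc j)\<bar> * \<bar>cW j\<bar>)
     + (\<Sum>i\<in>{2..n-1}. \<bar>gl E i / gl \<Omega> i\<bar> * \<bar>cL i\<bar>)
     + (\<Sum>i\<in>{2..n-1}. \<bar>gu E i / gu \<Omega> i\<bar> * \<bar>cU i\<bar>)"

lemma abs_weighted_sum_le:
  fixes x c w :: "'i \<Rightarrow> real"
  assumes "\<And>k. k \<in> K \<Longrightarrow> \<bar>x k\<bar> \<le> \<eta> * w k"
  shows "\<bar>\<Sum>k\<in>K. x k * c k\<bar> \<le> \<eta> * (\<Sum>k\<in>K. w k * \<bar>c k\<bar>)"
proof -
  have "\<bar>\<Sum>k\<in>K. x k * c k\<bar> \<le> (\<Sum>k\<in>K. \<eta> * w k * \<bar>c k\<bar>)"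
    by (rule order_trans[OF sum_abs sum_mono]) (simp add: abs_mult mult_right_mono assms)
  then show ?thesis by (simp add: sum_distrib_left mult.assoc)
qed

lemma abs_gv_form_le:
  assumes "0 \<le> \<eta>" and bd: "gv_bounded n \<eta> E \<Delta>" and \<delta>: "\<forall>k\<in>{1..M}. \<bar>\<delta> k\<bar> \<le> \<eta> * f k"
  shows "\<bar>gv_form n M \<Omega> cB cD cV cW cL cU \<Delta> \<delta>\<bar> \<le> \<eta> * gv_weight n M \<Omega> cB cD cV cW cL cU E f"
proof -
  have quot: "\<bar>d / x\<bar> \<le> \<eta> * \<bar>e / x\<bar>" if "\<bar>d\<bar> \<le> \<eta> * e" for d e x :: real
  proof -
    have "\<eta> * e \<le> \<eta> * \<bar>e\<bar>" using \<open>0 \<le> \<eta>\<close> by (intro mult_left_mono) auto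
    then have "\<bar>d\<bar> / \<bar>x\<bar> \<le> \<eta> * \<bar>e\<bar> / \<bar>x\<bar>" using that by (intro divide_right_mono) auto
    then show ?thesis by simp
  qed
  have 1: "\<bar>\<Sum>k\<in>{1..M}. \<delta> k * cB k\<bar> \<le> \<eta> * (\<Sum>k\<in>{1..M}. f k * \<bar>cB k\<bar>)"
    using \<delta> by (intro abs_weighted_sum_le) auto
  have 2: "\<bar>\<Sum>j<n. gd \<Delta> (Suc j) * cD j\<bar> \<le> \<eta> * (\<Sum>j<n. \<bar>gd E (Suc j)\<bar> * \<bar>cD j\<bar>)"
    using bd quot[of _ _ 1] by (intro abs_weighted_sum_le) (auto simp: gv_bounded_def)
  have 3: "\<bar>\<Sum>j<n-1. gv \<Delta> (Suc j) / gv \<Omega> (Suc j) * cV j\<bar>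
      \<le> \<eta> * (\<Sum>j<n-1. \<bar>gv E (Suc j) / gv \<Omega> (Suc j)\<bar> * \<bar>cV j\<bar>)"
    using bd by (intro abs_weighted_sum_le quot) (auto simp: gv_bounded_def)
  have 4: "\<bar>\<Sum>j<n-1. gw \<Delta> (Suc j) / gw \<Omega> (Suc j) * cW j\<bar>
      \<le> \<eta> * (\<Sum>j<n-1. \<bar>gw E (Suc j) / gw \<Omega> (Suc j)\<bar> * \<bar>cW j\<bar>)"
    using bd by (intro abs_weighted_sum_le quot) (auto simp: gv_bounded_def)
  have 5: "\<bar>\<Sum>i\<in>{2..n-1}. gl \<Delta> i / gl \<Omega> i * cL i\<bar> \<le> \<eta> * (\<Sum>i\<in>{2..n-1}. \<bar>gl E i / gl \<Omega> i\<bar> * \<bar>cL i\<bar>)"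
    using bd by (intro abs_weighted_sum_le quot) (auto simp: gv_bounded_def)
  have 6: "\<bar>\<Sum>i\<in>{2..n-1}. gu \<Delta> i / gu \<Omega> i * cU i\<bar> \<le> \<eta> * (\<Sum>i\<in>{2..n-1}. \<bar>gu E i / gu \<Omega> i\<bar> * \<bar>cU i\<bar>)"
    using bd by (intro abs_weighted_sum_le quot) (auto simp: gv_bounded_def)
  show ?thesis
    using 1 2 3 4 5 6 unfolding gv_form_def gv_weight_def distrib_left abs_le_iff by linarith
qed

text \<open>
  A vertex of the box at which all terms of \<open>gv_form\<close> have the same sign.  The parameters of \<open>A\<close> enter
  \<open>gv_form\<close> with a minus sign, and those that are divided by a parameter also need the sign of the
  latter.  The coefficients of \<open>gd\<close>, \<open>gv\<close> and \<open>gw\<close> are indexed from 0, the parameters from 1.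
\<close>
definition gv_worst where
  "gv_worst \<Omega> cD cV cW cL cU E \<eta> =
     \<lparr> gl = (\<lambda>i. - (\<eta> * gl E i * sgn (gl \<Omega> i * cL i))),
       gv = (\<lambda>i. - (\<eta> * gv E i * sgn (gv \<Omega> i * cV (i - 1)))),
       gd = (\<lambda>i. - (\<eta> * gd E i * sgn (cD (i - 1)))),
       gw = (\<lambda>i. - (\<eta> * gw E i * sgn (gw \<Omega> i * cW (i - 1)))),
       gu = (\<lambda>i. - (\<eta> * gu E i * sgn (gu \<Omega> i * cU i))) \<rparr>"

lemma gv_worst_bounded:
  assumes "0 \<le> \<eta>" and "gv_nonneg n E"
  shows "gv_bounded n \<eta> E (gv_worst \<Omega> cD cV cW cL cU E \<eta>)"
proof -
  have "\<bar>- (\<eta> * e * sgn y)\<bar> \<le> \<eta> * e" if "0 \<le> e" for e y :: real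
    using that assms(1) by (auto simp: abs_mult abs_sgn_eq)
  then show ?thesis using assms(2) by (simp add: gv_worst_def gv_bounded_def gv_nonneg_def)
qed

lemma gv_form_worst:
  assumes "0 \<le> \<eta>" and nn: "gv_nonneg n E"
  shows "gv_form n M \<Omega> cB cD cV cW cL cU (gv_worst \<Omega> cD cV cW cL cU E \<eta>) (\<lambda>k. \<eta> * f k * sgn (cB k))
    = \<eta> * gv_weight n M \<Omega> cB cD cV cW cL cU E f"
proof -
  have quot: "- (\<eta> * e * sgn (x * c)) / x * c = - (\<eta> * (\<bar>e / x\<bar> * \<bar>c\<bar>))" if "0 \<le> e" for e x c :: real
  proof -
    have x: "sgn x / x = 1 / \<bar>x\<bar>" and c: "sgn c * c = \<bar>c\<bar>" by (auto simp: sgn_if)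
    have "- (\<eta> * e * sgn (x * c)) / x * c = - (\<eta> * (e * (sgn x / x) * (sgn c * c)))"
      by (simp add: sgn_mult)
    then show ?thesis using that unfolding x c by (simp add: abs_divide)
  qed
  have quot1: "- (\<eta> * e * sgn c) * c = - (\<eta> * (\<bar>e\<bar> * \<bar>c\<bar>))" if "0 \<le> e" for e c :: real
    using quot[OF that, of 1 c] by simp
  have 1: "(\<Sum>k\<in>{1..M}. \<eta> * f k * sgn (cB k) * cB k) = (\<Sum>k\<in>{1..M}. \<eta> * (f k * \<bar>cB k\<bar>))"
    by (intro sum.cong refl) (simp add: abs_sgn mult_ac)
  let ?\<Delta> = "gv_worst \<Omega> cD cV cW cL cU E \<eta>"
  have 2: "(\<Sum>j<n. gd ?\<Delta> (Suc j) * cD j) = (\<Sum>j<n. - (\<eta> * (\<bar>gd E (Suc j)\<bar> * \<bar>cD j\<bar>)))"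
    unfolding gv_worst_def gv_params.simps diff_Suc_1
    using nn by (intro sum.cong refl quot1) (auto simp: gv_nonneg_def)
  have 3: "(\<Sum>j<n-1. gv ?\<Delta> (Suc j) / gv \<Omega> (Suc j) * cV j)
      = (\<Sum>j<n-1. - (\<eta> * (\<bar>gv E (Suc j) / gv \<Omega> (Suc j)\<bar> * \<bar>cV j\<bar>)))"
    unfolding gv_worst_def gv_params.simps diff_Suc_1 
    using nn by (intro sum.cong refl quot) (auto simp: gv_nonneg_def)
  have 4: "(\<Sum>j<n-1. gw ?\<Delta> (Suc j) / gw \<Omega> (Suc j) * cW j)
      = (\<Sum>j<n-1. - (\<eta> * (\<bar>gw E (Suc j) / gw \<Omega> (Suc j)\<bar> * \<bar>cW j\<bar>)))"
    unfolding gv_worst_def gv_params.simps diff_Suc_1 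
    using nn by (intro sum.cong refl quot) (auto simp: gv_nonneg_def)
  have 5: "(\<Sum>i\<in>{2..n-1}. gl ?\<Delta> i / gl \<Omega> i * cL i) = (\<Sum>i\<in>{2..n-1}. - (\<eta> * (\<bar>gl E i / gl \<Omega> i\<bar> * \<bar>cL i\<bar>)))"
    unfolding gv_worst_def gv_params.simps
    using nn by (intro sum.cong refl quot) (auto simp: gv_nonneg_def)
  have 6: "(\<Sum>i\<in>{2..n-1}. gu ?\<Delta> i / gu \<Omega> i * cU i) = (\<Sum>i\<in>{2..n-1}. - (\<eta> * (\<bar>gu E i / gu \<Omega> i\<bar> * \<bar>cU i\<bar>)))"
    unfolding gv_worst_def gv_params.simps
    using nn by (intro sum.cong refl quot) (auto simp: gv_nonneg_def)
  show ?thesis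
    unfolding gv_form_def gv_weight_def 1 2 3 4 5 6 
    by (simp add: sum_negf sum_distrib_left distrib_left)
qed

text \<open>
  The coefficients of that linear form for the entry \<open>(p, q)\<close> of the solution, where \<open>Ai\<close> stands for the
  inverse of \<open>A\<close>.
\<close>
definition sens_B where "sens_B Ai S p q = (\<lambda>k. (Ai * S k) $$ (p, q))" for Ai :: "real mat"
definition sens_D where "sens_D Ai X p q = (\<lambda>j. Ai $$ (p, j) * X $$ (j, q))" for Ai :: "real mat"
definition sens_V where "sens_V Ai A X p q = (\<lambda>j. (Ai * strict_lower A) $$ (p, j) * X $$ (j, q))"
definition sens_W where "sens_W Ai A X p q = (\<lambda>j. Ai $$ (p, j) * (strict_upper A * X) $$ (j, q))"
definition sens_L where "sens_L n \<Omega> Ai A X p q = (\<lambda>i. (Ai * lower_block n \<Omega> A i * X) $$ (p, q))"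
definition sens_U where "sens_U n \<Omega> Ai A X p q = (\<lambda>i. (Ai * upper_block n \<Omega> A i * X) $$ (p, q))"

lemma strict_lower_carrier: "A \<in> carrier_mat n n \<Longrightarrow> strict_lower A \<in> carrier_mat n n"
  and strict_upper_carrier: "A \<in> carrier_mat n n \<Longrightarrow> strict_upper A \<in> carrier_mat n n"
  and lower_block_carrier: "lower_block n \<Omega> A i \<in> carrier_mat n n"
  and upper_block_carrier: "upper_block n \<Omega> A i \<in> carrier_mat n n"
  and gv_mat_carrier: "gv_mat n \<Omega> \<in> carrier_mat n n"
  by (auto simp: strict_lower_def strict_upper_def lower_block_def upper_block_def gv_mat_def)

lemma sum_lessThan_drop_last:
  fixes f :: "nat \<Rightarrow> real"
  assumes "1 \<le> n" "f (n - 1) = 0"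
  shows "(\<Sum>j<n. f j) = (\<Sum>j<n-1. f j)"
  using assms sum.lessThan_Suc[of f "n - 1"] by simp

lemma sens_V_last:
  assumes "1 \<le> n" "p < n" "Ai \<in> carrier_mat n n" "A \<in> carrier_mat n n"
  shows "sens_V Ai A X p q (n - 1) = 0"
proof -
  have "(Ai * strict_lower A) $$ (p, n - 1) = (\<Sum>a<n. Ai $$ (p, a) * strict_lower A $$ (a, n - 1))"
    using assms by (intro mat_mult_entry[OF _ strict_lower_carrier]) auto
  also have "\<dots> = 0" using assms by (intro sum.neutral) (auto simp: strict_lower_def)
  finally show ?thesis by (simp add: sens_V_def)
qed

lemma sens_W_last:
  assumes "1 \<le> n" "q < m" "A \<in> carrier_mat n n" "X \<in> carrier_mat n m"
  shows "sens_W Ai A X p q (n - 1) = 0"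
proof -
  have "(strict_upper A * X) $$ (n - 1, q) = (\<Sum>b<n. strict_upper A $$ (n - 1, b) * X $$ (b, q))"
    using assms by (intro mat_mult_entry[OF strict_upper_carrier]) auto
  also have "\<dots> = 0" using assms by (intro sum.neutral) (auto simp: strict_upper_def)
  finally show ?thesis by (simp add: sens_W_def)
qed

lemma sum_sandwich_sum:
  fixes x z :: "nat \<Rightarrow> real" and Y :: "'i \<Rightarrow> nat \<Rightarrow> nat \<Rightarrow> real"
  shows "(\<Sum>a<n. \<Sum>b<n. x a * ((\<Sum>i\<in>I. r i * Y i a b) * z b)) = (\<Sum>i\<in>I. r i * (\<Sum>a<n. \<Sum>b<n. x a * (Y i a b * z b)))"
proof -
  have "(\<Sum>a<n. \<Sum>b<n. x a * ((\<Sum>i\<in>I. r i * Y i a b) * z b)) = (\<Sum>a<n. \<Sum>b<n. \<Sum>i\<in>I. r i * (x a * (Y i a b * z b)))"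
    by (simp add: sum_distrib_left sum_distrib_right mult_ac)
  also have "\<dots> = (\<Sum>a<n. \<Sum>i\<in>I. \<Sum>b<n. r i * (x a * (Y i a b * z b)))"
    by (intro sum.cong refl sum.swap)
  also have "\<dots> = (\<Sum>i\<in>I. \<Sum>a<n. \<Sum>b<n. r i * (x a * (Y i a b * z b)))"
    by (rule sum.swap)
  finally show ?thesis by (simp add: sum_distrib_left)
qed

lemma mat_mult3_entry:
  assumes "P \<in> carrier_mat n n" "Z \<in> carrier_mat n n" "X \<in> carrier_mat n m" "p < n" "q < m"
  shows "(P * Z * X) $$ (p, q) = (\<Sum>a<n. \<Sum>b<n. P $$ (p, a) * (Z $$ (a, b) * X $$ (b, q)))"
proof -
  have "(P * Z * X) $$ (p, q) = (P * (Z * X)) $$ (p, q)"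
    using assoc_mult_mat[OF assms(1-3)] by simp
  also have "\<dots> = (\<Sum>a<n. P $$ (p, a) * (Z * X) $$ (a, q))"
    by (rule mat_mult_entry[OF assms(1) mult_carrier_mat[OF assms(2,3)] assms(4,5)])
  also have "\<dots> = (\<Sum>a<n. P $$ (p, a) * (\<Sum>b<n. Z $$ (a, b) * X $$ (b, q)))"
    by (intro sum.cong refl arg_cong2[where f = "(*)"] mat_mult_entry[OF assms(2,3) _ assms(5)]) simp
  finally show ?thesis by (simp add: sum_distrib_left)
qed

text \<open>
  The left-hand side is the entry \<open>(p, q)\<close> of \<open>Ai * (dB - dA * X)\<close>, written with sums because \<open>dA\<close> is given entry
  by entry; exchanging the sums collects the factor of each parameter perturbation.
\<close>
lemma first_order_solution_eq_gv_form:
  fixes Ai X :: "real mat" and S :: "nat \<Rightarrow> real mat" and \<Omega> :: gv_params and n :: nat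
  assumes n: "1 \<le> n" and Ai: "Ai \<in> carrier_mat n n" and X: "X \<in> carrier_mat n m"
    and S: "\<forall>k\<in>{1..M}. S k \<in> carrier_mat n m" and pq: "p < n" "q < m"
  defines "A \<equiv> gv_mat n \<Omega>"
  shows "(\<Sum>a<n. Ai $$ (p, a) * ((\<Sum>k\<in>{1..M}. \<delta> k * S k $$ (a, q)) - (\<Sum>b<n. gv_differential n \<Omega> \<Delta> a b * X $$ (b, q))))
    = gv_form n M \<Omega> (sens_B Ai S p q) (sens_D Ai X p q) (sens_V Ai A X p q) (sens_W Ai A X p q)
        (sens_L n \<Omega> Ai A X p q) (sens_U n \<Omega> Ai A X p q) \<Delta> \<delta>"
proof -
  have A: "A \<in> carrier_mat n n" unfolding A_def by (rule gv_mat_carrier)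
  let ?rv = "\<lambda>j. gv \<Delta> (Suc j) / gv \<Omega> (Suc j)" and ?rw = "\<lambda>j. gw \<Delta> (Suc j) / gw \<Omega> (Suc j)"
  let ?l = "\<lambda>a b. \<Sum>i\<in>{2..n-1}. gl \<Delta> i / gl \<Omega> i * lower_block n \<Omega> A i $$ (a, b)"
  let ?u = "\<lambda>a b. \<Sum>i\<in>{2..n-1}. gu \<Delta> i / gu \<Omega> i * upper_block n \<Omega> A i $$ (a, b)"
  have B: "(\<Sum>a<n. Ai $$ (p, a) * (\<Sum>k\<in>{1..M}. \<delta> k * S k $$ (a, q))) = (\<Sum>k\<in>{1..M}. \<delta> k * sens_B Ai S p q k)"
  proof -
    have "(\<Sum>a<n. Ai $$ (p, a) * (\<Sum>k\<in>{1..M}. \<delta> k * S k $$ (a, q)))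
      = (\<Sum>k\<in>{1..M}. \<Sum>a<n. \<delta> k * (Ai $$ (p, a) * S k $$ (a, q)))"
      unfolding sum_distrib_left by (subst sum.swap) (simp add: mult_ac)
    also have "\<dots> = (\<Sum>k\<in>{1..M}. \<delta> k * sens_B Ai S p q k)"
      unfolding sens_B_def using mat_mult_entry[OF Ai bspec[OF S] pq] by (intro sum.cong refl) (simp add: sum_distrib_left)
    finally show ?thesis .
  qed
  have D: "(\<Sum>a<n. \<Sum>b<n. Ai $$ (p, a) * ((if a = b then gd \<Delta> (Suc a) else 0) * X $$ (b, q)))
      = (\<Sum>j<n. gd \<Delta> (Suc j) * sens_D Ai X p q j)"
  proof (intro sum.cong refl)
    fix a assume "a \<in> {..<n}"
    have "(\<Sum>b<n. Ai $$ (p, a) * ((if a = b then gd \<Delta> (Suc a) else 0) * X $$ (b, q)))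
      = (\<Sum>b<n. if a = b then gd \<Delta> (Suc a) * sens_D Ai X p q a else 0)"
      by (intro sum.cong refl) (auto simp: sens_D_def)
    then show "(\<Sum>b<n. Ai $$ (p, a) * ((if a = b then gd \<Delta> (Suc a) else 0) * X $$ (b, q)))
      = gd \<Delta> (Suc a) * sens_D Ai X p q a"
      using \<open>a \<in> {..<n}\<close> by simp
  qed
  have V: "(\<Sum>a<n. \<Sum>b<n. Ai $$ (p, a) * (strict_lower A $$ (a, b) * ?rv b * X $$ (b, q)))
      = (\<Sum>j<n-1. ?rv j * sens_V Ai A X p q j)"
  proof -
    have "(\<Sum>a<n. \<Sum>b<n. Ai $$ (p, a) * (strict_lower A $$ (a, b) * ?rv b * X $$ (b, q)))
      = (\<Sum>b<n. ?rv b * ((\<Sum>a<n. Ai $$ (p, a) * strict_lower A $$ (a, b)) * X $$ (b, q)))"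
      by (subst sum.swap) (simp add: sum_distrib_left sum_distrib_right mult_ac)
    also have "\<dots> = (\<Sum>b<n. ?rv b * sens_V Ai A X p q b)"
      unfolding sens_V_def using mat_mult_entry[OF Ai strict_lower_carrier[OF A] pq(1)]
      by (intro sum.cong refl) simp
    also have "\<dots> = (\<Sum>j<n-1. ?rv j * sens_V Ai A X p q j)"
      using n sens_V_last[OF n pq(1) Ai A] by (intro sum_lessThan_drop_last) auto
    finally show ?thesis .
  qed
  have W: "(\<Sum>a<n. \<Sum>b<n. Ai $$ (p, a) * (?rw a * strict_upper A $$ (a, b) * X $$ (b, q)))
      = (\<Sum>j<n-1. ?rw j * sens_W Ai A X p q j)"
  proof -
    have "(\<Sum>a<n. \<Sum>b<n. Ai $$ (p, a) * (?rw a * strict_upper A $$ (a, b) * X $$ (b, q)))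
      = (\<Sum>a<n. ?rw a * (Ai $$ (p, a) * (\<Sum>b<n. strict_upper A $$ (a, b) * X $$ (b, q))))"
      by (simp add: sum_distrib_left mult_ac)
    also have "\<dots> = (\<Sum>a<n. ?rw a * sens_W Ai A X p q a)"
      unfolding sens_W_def using mat_mult_entry[OF strict_upper_carrier[OF A] X _ pq(2)]
      by (intro sum.cong refl) simp
    also have "\<dots> = (\<Sum>j<n-1. ?rw j * sens_W Ai A X p q j)"
      using n sens_W_last[OF n pq(2) A X] by (intro sum_lessThan_drop_last) auto
    finally show ?thesis .
  qed
  have L: "(\<Sum>a<n. \<Sum>b<n. Ai $$ (p, a) * (?l a b * X $$ (b, q))) = (\<Sum>i\<in>{2..n-1}. gl \<Delta> i / gl \<Omega> i * sens_L n \<Omega> Ai A X p q i)"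
    unfolding sens_L_def mat_mult3_entry[OF Ai lower_block_carrier X pq] by (rule sum_sandwich_sum)
  have U: "(\<Sum>a<n. \<Sum>b<n. Ai $$ (p, a) * (?u a b * X $$ (b, q))) = (\<Sum>i\<in>{2..n-1}. gu \<Delta> i / gu \<Omega> i * sens_U n \<Omega> Ai A X p q i)"
    unfolding sens_U_def mat_mult3_entry[OF Ai upper_block_carrier X pq] by (rule sum_sandwich_sum)
  have split: "x * ((d + v + w + l + u) * y) = x * (d * y) + x * (v * y) + x * (w * y) + x * (l * y) + x * (u * y)"
    for x d v w l u y :: real by (simp add: algebra_simps)
  have "(\<Sum>a<n. Ai $$ (p, a) * (\<Sum>b<n. gv_differential n \<Omega> \<Delta> a b * X $$ (b, q)))
    = (\<Sum>j<n. gd \<Delta> (Suc j) * sens_D Ai X p q j) + (\<Sum>j<n-1. ?rv j * sens_V Ai A X p q j)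
      + (\<Sum>j<n-1. ?rw j * sens_W Ai A X p q j)
      + (\<Sum>i\<in>{2..n-1}. gl \<Delta> i / gl \<Omega> i * sens_L n \<Omega> Ai A X p q i)
      + (\<Sum>i\<in>{2..n-1}. gu \<Delta> i / gu \<Omega> i * sens_U n \<Omega> Ai A X p q i)"
    unfolding gv_differential_def A_def[symmetric] sum_distrib_left split sum.distrib D V W
      L[unfolded sum_distrib_left] U[unfolded sum_distrib_left] ..
  then show ?thesis
    unfolding right_diff_distrib sum_subtractf B gv_form_def by simp
qed

lemma sparse_mat_entry:
  assumes "\<forall>k\<in>{1..M}. S k \<in> carrier_mat n m" "p < n" "q < m"
  shows "sparse_mat n m M S \<omega> $$ (p, q) = (\<Sum>k\<in>{1..M}. \<omega> k * S k $$ (p, q))"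
proof -
  have "sparse_mat n m M S \<omega> $$ (p, q) = (\<Sum>k\<in>{1..M}. (\<omega> k \<cdot>\<^sub>m S k) $$ (p, q))"
    using assms(2,3) by (simp add: sparse_mat_def mat_sum_def)
  also have "\<dots> = (\<Sum>k\<in>{1..M}. \<omega> k * S k $$ (p, q))"
  proof (intro sum.cong refl)
    fix k assume "k \<in> {1..M}"
    then show "(\<omega> k \<cdot>\<^sub>m S k) $$ (p, q) = \<omega> k * S k $$ (p, q)" using bspec[OF assms(1), of k] assms(2,3) by auto
  qed
  finally show ?thesis .
qed

lemma gv_solution_first_order:
  fixes Ai X :: "real mat" and S :: "nat \<Rightarrow> real mat" and \<Omega> :: gv_params and n :: nat
  assumes \<eta>: "(\<eta> \<longlongrightarrow> 0) F" and n: "1 \<le> n" and Ai: "Ai \<in> carrier_mat n n"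
    and X: "X \<in> carrier_mat n m" and S: "\<forall>k\<in>{1..M}. S k \<in> carrier_mat n m"
    and inv: "Ai * gv_mat n \<Omega> = 1\<^sub>m n" and AX: "gv_mat n \<Omega> * X = sparse_mat n m M S \<omega>"
    and ok: "gv_quotients_ok n \<Omega> E"
    and bd: "eventually (\<lambda>z. gv_bounded n (\<eta> z) E (\<Delta> z)) F"
    and \<delta>: "eventually (\<lambda>z. \<forall>k\<in>{1..M}. \<bar>\<delta> z k\<bar> \<le> \<eta> z * f k) F"
    and sol: "eventually (\<lambda>z. DX z \<in> carrier_mat n m \<and>
      gv_mat n (gv_add \<Omega> (\<Delta> z)) * (X + DX z) = sparse_mat n m M S (\<lambda>k. \<omega> k + \<delta> z k)) F"
    and pq: "p < n" "q < m"
  defines "A \<equiv> gv_mat n \<Omega>"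
  shows "(\<lambda>z. DX z $$ (p, q) - gv_form n M \<Omega> (sens_B Ai S p q) (sens_D Ai X p q) (sens_V Ai A X p q)
     (sens_W Ai A X p q) (sens_L n \<Omega> Ai A X p q) (sens_U n \<Omega> Ai A X p q) (\<Delta> z) (\<delta> z)) \<in> o[F](\<eta>)"
proof -
  have sp: "sparse_mat n m M S w \<in> carrier_mat n m" for w by (simp add: sparse_mat_def mat_sum_def)
  have dB: "(\<lambda>z. \<Sum>k\<in>{1..M}. \<delta> z k * S k $$ (a, q)) \<in> O[F](\<eta>)" for a q
  proof (intro big_sum_in_bigo bigo_scale(2))
    fix k assume "k \<in> {1..M}"
    then show "(\<lambda>z. \<delta> z k) \<in> O[F](\<eta>)"
      by (intro bounded_imp_bigo[of _ _ "f k"] eventually_mono[OF \<delta>]) auto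
  qed
  have rB: "(\<lambda>z. sparse_mat n m M S (\<lambda>k. \<omega> k + \<delta> z k) $$ (a, q) - sparse_mat n m M S \<omega> $$ (a, q)
      - (\<Sum>k\<in>{1..M}. \<delta> z k * S k $$ (a, q))) \<in> o[F](\<eta>)" if "a < n" "q < m" for a q
    unfolding sparse_mat_entry[OF S that] by (simp add: distrib_right sum.distrib)
  show ?thesis
    unfolding A_def first_order_solution_eq_gv_form[OF n Ai X S pq, symmetric]
    by (rule perturbed_solution_first_order[where A' = "\<lambda>z. gv_mat n (gv_add \<Omega> (\<Delta> z))"
          and B' = "\<lambda>z. sparse_mat n m M S (\<lambda>k. \<omega> k + \<delta> z k)",
          OF \<eta> gv_mat_carrier Ai inv X sp AX gv_mat_carrier sp sol gv_mat_first_order[OF \<eta> ok bd] dB rB pq])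
qed

section \<open>The matrix inside the norm\<close>

lemma abs_mat_carrier: "Z \<in> carrier_mat n m \<Longrightarrow> abs_mat Z \<in> carrier_mat n m"
  by (simp add: abs_mat_def)

lemma abs_mat_entry: "Z \<in> carrier_mat n m \<Longrightarrow> p < n \<Longrightarrow> q < m \<Longrightarrow> abs_mat Z $$ (p, q) = \<bar>Z $$ (p, q)\<bar>"
  by (simp add: abs_mat_def)

lemma abs_diag_mult_entry:
  assumes P: "P \<in> carrier_mat n n" and Y: "Y \<in> carrier_mat n m" and pq: "p < n" "q < m"
  shows "(abs_mat P * abs_mat (mat_diag n d) * abs_mat Y) $$ (p, q) = (\<Sum>j<n. \<bar>d j\<bar> * \<bar>P $$ (p, j) * Y $$ (j, q)\<bar>)"
proof -
  have D: "mat_diag n d \<in> carrier_mat n n" by simp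
  have "(abs_mat P * abs_mat (mat_diag n d) * abs_mat Y) $$ (p, q)
      = (\<Sum>a<n. \<Sum>b<n. \<bar>P $$ (p, a)\<bar> * (\<bar>mat_diag n d $$ (a, b)\<bar> * \<bar>Y $$ (b, q)\<bar>))"
    using mat_mult3_entry[OF abs_mat_carrier[OF P] abs_mat_carrier[OF D] abs_mat_carrier[OF Y] pq]
      pq by (simp add: abs_mat_entry[OF P] abs_mat_entry[OF D] abs_mat_entry[OF Y])
  also have "\<dots> = (\<Sum>a<n. \<Sum>b<n. if a = b then \<bar>P $$ (p, a)\<bar> * (\<bar>d a\<bar> * \<bar>Y $$ (a, q)\<bar>) else 0)"
    by (intro sum.cong refl) (auto simp: mat_diag_def)
  also have "\<dots> = (\<Sum>j<n. \<bar>d j\<bar> * \<bar>P $$ (p, j) * Y $$ (j, q)\<bar>)"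
    by (simp add: abs_mult mult_ac)
  finally show ?thesis .
qed

text \<open>
  The last diagonal entry 1 of \<open>D_v\<close> and \<open>D_w\<close> meets the zero last column of \<open>strict_lower A\<close>, respectively the
  zero last row of \<open>strict_upper A\<close>; no parameter belongs to it.
\<close>
lemma mat_diag_cond_entry:
  assumes n: "1 \<le> n" and P: "P \<in> carrier_mat n n" and Y: "Y \<in> carrier_mat n m" and pq: "p < n" "q < m"
    and last: "P $$ (p, n - 1) * Y $$ (n - 1, q) = 0"
  shows "(abs_mat P * abs_mat (mat_diag n (\<lambda>j. if Suc j < n then d j else 1)) * abs_mat Y) $$ (p, q)
    = (\<Sum>j<n-1. \<bar>d j\<bar> * \<bar>P $$ (p, j) * Y $$ (j, q)\<bar>)"
proof -
  have "(abs_mat P * abs_mat (mat_diag n (\<lambda>j. if Suc j < n then d j else 1)) * abs_mat Y) $$ (p, q)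
    = (\<Sum>j<n-1. \<bar>if Suc j < n then d j else 1\<bar> * \<bar>P $$ (p, j) * Y $$ (j, q)\<bar>)"
    unfolding abs_diag_mult_entry[OF P Y pq] using n last by (intro sum_lessThan_drop_last) auto
  also have "\<dots> = (\<Sum>j<n-1. \<bar>d j\<bar> * \<bar>P $$ (p, j) * Y $$ (j, q)\<bar>)" by (intro sum.cong) auto
  finally show ?thesis .
qed

definition cond_matrix :: "nat \<Rightarrow> nat \<Rightarrow> nat \<Rightarrow> (nat \<Rightarrow> real mat) \<Rightarrow> gv_params \<Rightarrow> gv_params \<Rightarrow> (nat \<Rightarrow> real) \<Rightarrow> real mat \<Rightarrow> real mat \<Rightarrow> real mat \<Rightarrow> real mat" where
  "cond_matrix n m M S \<Omega> E f Ai A X =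
        mat_sum n m (\<lambda>k. f k \<cdot>\<^sub>m abs_mat (Ai * S k)) {1..M}
      + abs_mat Ai * abs_mat (D_d n E) * abs_mat X
      + abs_mat (Ai * strict_lower A) * abs_mat (D_v n \<Omega> E) * abs_mat X
      + abs_mat Ai * abs_mat (D_w n \<Omega> E) * abs_mat (strict_upper A * X)
      + mat_sum n m (\<lambda>i. \<bar>gl E i / gl \<Omega> i\<bar> \<cdot>\<^sub>m abs_mat (Ai * lower_block n \<Omega> A i * X)) {2..n-1}
      + mat_sum n m (\<lambda>i. \<bar>gu E i / gu \<Omega> i\<bar> \<cdot>\<^sub>m abs_mat (Ai * upper_block n \<Omega> A i * X)) {2..n-1}"

lemma mat_sum_scaled_abs_entry:
  assumes "\<And>i. i \<in> I \<Longrightarrow> Z i \<in> carrier_mat n m" "p < n" "q < m"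
  shows "mat_sum n m (\<lambda>i. w i \<cdot>\<^sub>m abs_mat (Z i)) I $$ (p, q) = (\<Sum>i\<in>I. w i * \<bar>Z i $$ (p, q)\<bar>)"
proof -
  have "mat_sum n m (\<lambda>i. w i \<cdot>\<^sub>m abs_mat (Z i)) I $$ (p, q) = (\<Sum>i\<in>I. (w i \<cdot>\<^sub>m abs_mat (Z i)) $$ (p, q))"
    using assms(2,3) by (simp add: mat_sum_def)
  also have "\<dots> = (\<Sum>i\<in>I. w i * \<bar>Z i $$ (p, q)\<bar>)"
  proof (intro sum.cong refl)
    fix i assume "i \<in> I"
    then show "(w i \<cdot>\<^sub>m abs_mat (Z i)) $$ (p, q) = w i * \<bar>Z i $$ (p, q)\<bar>"
      using assms(1)[of i] assms(2,3) by (auto simp: abs_mat_def)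
  qed
  finally show ?thesis .
qed

lemma cond_matrix_carrier:
  "cond_matrix n m M S \<Omega> E f Ai A X \<in> carrier_mat n m"
  by (auto simp: cond_matrix_def mat_sum_def)

lemma cond_matrix_entry:
  assumes n: "1 \<le> n" and Ai: "Ai \<in> carrier_mat n n" and A: "A \<in> carrier_mat n n"
    and X: "X \<in> carrier_mat n m"
    and S: "\<forall>k\<in>{1..M}. S k \<in> carrier_mat n m" and pq: "p < n" "q < m"
  shows "cond_matrix n m M S \<Omega> E f Ai A X $$ (p, q) =
     gv_weight n M \<Omega> (sens_B Ai S p q) (sens_D Ai X p q) (sens_V Ai A X p q)
     (sens_W Ai A X p q) (sens_L n \<Omega> Ai A X p q) (sens_U n \<Omega> Ai A X p q) E f"
proof -
  note SL = mult_carrier_mat[OF Ai strict_lower_carrier[OF A]]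
  note SU = mult_carrier_mat[OF strict_upper_carrier[OF A] X]
  have L: "Ai * lower_block n \<Omega> A i * X \<in> carrier_mat n m" for i
    using mult_carrier_mat[OF mult_carrier_mat[OF Ai lower_block_carrier] X] .
  have U: "Ai * upper_block n \<Omega> A i * X \<in> carrier_mat n m" for i
    using mult_carrier_mat[OF mult_carrier_mat[OF Ai upper_block_carrier] X] .
  have P: "abs_mat P * abs_mat (mat_diag n d) * abs_mat Y \<in> carrier_mat n m"
    if "P \<in> carrier_mat n n" "Y \<in> carrier_mat n m" for P Y d
    using mult_carrier_mat[OF mult_carrier_mat[OF abs_mat_carrier[OF that(1)] abs_mat_carrier] abs_mat_carrier[OF that(2)]]
    by simp
  have MS: "mat_sum n m G I \<in> carrier_mat n m" for G :: "nat \<Rightarrow> real mat" and I by (simp add: mat_sum_def)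
  note entry = index_add_mat(1)[where i = p and j = q]
  have 1: "mat_sum n m (\<lambda>k. f k \<cdot>\<^sub>m abs_mat (Ai * S k)) {1..M} $$ (p, q) = (\<Sum>k\<in>{1..M}. f k * \<bar>sens_B Ai S p q k\<bar>)"
    unfolding sens_B_def using mult_carrier_mat[OF Ai bspec[OF S]] pq by (intro mat_sum_scaled_abs_entry) auto
  have 2: "(abs_mat Ai * abs_mat (D_d n E) * abs_mat X) $$ (p, q) = (\<Sum>j<n. \<bar>gd E (Suc j)\<bar> * \<bar>sens_D Ai X p q j\<bar>)"
    unfolding sens_D_def D_d_def by (rule abs_diag_mult_entry[OF Ai X pq])
  have 3: "(abs_mat (Ai * strict_lower A) * abs_mat (D_v n \<Omega> E) * abs_mat X) $$ (p, q)
      = (\<Sum>j<n-1. \<bar>gv E (Suc j) / gv \<Omega> (Suc j)\<bar> * \<bar>sens_V Ai A X p q j\<bar>)"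
    using sens_V_last[OF n pq(1) Ai A] unfolding sens_V_def D_v_def by (rule mat_diag_cond_entry[OF n SL X pq])
  have 4: "(abs_mat Ai * abs_mat (D_w n \<Omega> E) * abs_mat (strict_upper A * X)) $$ (p, q)
      = (\<Sum>j<n-1. \<bar>gw E (Suc j) / gw \<Omega> (Suc j)\<bar> * \<bar>sens_W Ai A X p q j\<bar>)"
    using sens_W_last[OF n pq(2) A X, of Ai p] unfolding sens_W_def D_w_def by (rule mat_diag_cond_entry[OF n Ai SU pq])
  have 5: "mat_sum n m (\<lambda>i. \<bar>gl E i / gl \<Omega> i\<bar> \<cdot>\<^sub>m abs_mat (Ai * lower_block n \<Omega> A i * X)) {2..n-1} $$ (p, q)
      = (\<Sum>i\<in>{2..n-1}. \<bar>gl E i / gl \<Omega> i\<bar> * \<bar>sens_L n \<Omega> Ai A X p q i\<bar>)"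
    unfolding sens_L_def using L pq by (rule mat_sum_scaled_abs_entry)
  have 6: "mat_sum n m (\<lambda>i. \<bar>gu E i / gu \<Omega> i\<bar> \<cdot>\<^sub>m abs_mat (Ai * upper_block n \<Omega> A i * X)) {2..n-1} $$ (p, q)
      = (\<Sum>i\<in>{2..n-1}. \<bar>gu E i / gu \<Omega> i\<bar> * \<bar>sens_U n \<Omega> Ai A X p q i\<bar>)"
    unfolding sens_U_def using U pq by (rule mat_sum_scaled_abs_entry)
  have dims: "dim_row (mat_sum n m G I) = n" "dim_col (mat_sum n m G I) = m" for G :: "nat \<Rightarrow> real mat" and I
    by (simp_all add: mat_sum_def)
  have adims: "dim_row (abs_mat Z) = dim_row Z" "dim_col (abs_mat Z) = dim_col Z" for Z
    by (simp_all add: abs_mat_def)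
  have "cond_matrix n m M S \<Omega> E f Ai A X $$ (p, q) =
      mat_sum n m (\<lambda>k. f k \<cdot>\<^sub>m abs_mat (Ai * S k)) {1..M} $$ (p, q)
      + (abs_mat Ai * abs_mat (D_d n E) * abs_mat X) $$ (p, q)
      + (abs_mat (Ai * strict_lower A) * abs_mat (D_v n \<Omega> E) * abs_mat X) $$ (p, q)
      + (abs_mat Ai * abs_mat (D_w n \<Omega> E) * abs_mat (strict_upper A * X)) $$ (p, q)
      + mat_sum n m (\<lambda>i. \<bar>gl E i / gl \<Omega> i\<bar> \<cdot>\<^sub>m abs_mat (Ai * lower_block n \<Omega> A i * X)) {2..n-1} $$ (p, q)
      + mat_sum n m (\<lambda>i. \<bar>gu E i / gu \<Omega> i\<bar> \<cdot>\<^sub>m abs_mat (Ai * upper_block n \<Omega> A i * X)) {2..n-1} $$ (p, q)"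
    unfolding cond_matrix_def using pq Ai X A by (simp add: dims adims del: index_mult_mat(1))
  then show ?thesis unfolding 1 2 3 4 5 6 gv_weight_def .
qed

section \<open>The limit of the largest relative change\<close>

lemma Sup_ereal_tendsto:
  fixes C :: "'z \<Rightarrow> real set"
  assumes upper: "\<And>\<epsilon>. 0 < \<epsilon> \<Longrightarrow> eventually (\<lambda>z. \<forall>x\<in>C z. x \<le> c + \<epsilon>) F"
    and lower: "\<And>\<epsilon>. 0 < \<epsilon> \<Longrightarrow> eventually (\<lambda>z. \<exists>x\<in>C z. c - \<epsilon> \<le> x) F"
  shows "((\<lambda>z. Sup (ereal ` C z)) \<longlongrightarrow> ereal c) F"
proof (rule order_tendstoI)
  fix y assume "y < ereal c"
  then obtain r where r: "y < ereal r" "ereal r < ereal c" using ereal_dense2 by blast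
  then have "eventually (\<lambda>z. \<exists>x\<in>C z. c - (c - r) \<le> x) F" by (intro lower) simp
  then show "eventually (\<lambda>z. y < Sup (ereal ` C z)) F"
  proof eventually_elim
    case (elim z)
    then obtain x where x: "x \<in> C z" "ereal r \<le> ereal x" by auto
    have "y < ereal r" by (rule r)
    also have "\<dots> \<le> ereal x" by (rule x)
    also have "\<dots> \<le> Sup (ereal ` C z)" using x by (intro Sup_upper) auto
    finally show ?case .
  qed
next
  fix y assume "ereal c < y"
  then obtain r where r: "ereal c < ereal r" "ereal r < y" using ereal_dense2 by blast
  then have "eventually (\<lambda>z. \<forall>x\<in>C z. x \<le> c + (r - c)) F" by (intro upper) simp
  then show "eventually (\<lambda>z. Sup (ereal ` C z) < y) F"
  proof eventually_elim
    case (elim z)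
    then have "Sup (ereal ` C z) \<le> ereal r" by (auto intro!: Sup_least)
    then show ?case using r(2) by (rule le_less_trans)
  qed
qed

lemma gv_entries_tendsto:
  assumes \<eta>: "(\<eta> \<longlongrightarrow> 0) F" and ok: "gv_quotients_ok n \<Omega> E"
    and bd: "eventually (\<lambda>z. gv_bounded n (\<eta> z) E (\<Delta> z)) F"
    and ab: "a < n" "b < n"
  shows "((\<lambda>z. gv_mat n (gv_add \<Omega> (\<Delta> z)) $$ (a, b)) \<longlongrightarrow> gv_mat n \<Omega> $$ (a, b)) F"
proof -
  note fo = gv_mat_first_order[OF \<eta> ok bd ab]
  have "(\<lambda>z. gv_mat n (gv_add \<Omega> (\<Delta> z)) $$ (a, b) - gv_mat n \<Omega> $$ (a, b)) \<in> O[F](\<eta>)"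
    using sum_in_bigo(1)[OF landau_o.small_imp_big[OF fo(2)] fo(1)] by simp
  from smalloD_tendsto[OF bigo_of_vanishing_is_smallo_1[OF \<eta> this]]
  show ?thesis by (simp add: LIM_zero_iff)
qed

locale gv_system =
  fixes n m M :: nat and Ai X :: "real mat" and S :: "nat \<Rightarrow> real mat"
    and \<Omega> E :: gv_params and \<omega> f :: "nat \<Rightarrow> real"
  assumes n: "1 \<le> n" and m: "1 \<le> m" and Ai: "Ai \<in> carrier_mat n n" and X: "X \<in> carrier_mat n m"
    and S: "\<forall>k\<in>{1..M}. S k \<in> carrier_mat n m"
    and inv: "Ai * gv_mat n \<Omega> = 1\<^sub>m n" and AX: "gv_mat n \<Omega> * X = sparse_mat n m M S \<omega>"
    and f: "\<And>k. k \<in> {1..M} \<Longrightarrow> 0 \<le> f k" and E: "gv_nonneg n E" and ok: "gv_quotients_ok n \<Omega> E"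
    and X0: "0 < max_norm X"
begin

abbreviation "R \<equiv> cond_matrix n m M S \<Omega> E f Ai (gv_mat n \<Omega>) X"

lemma relative_changes_upper:
  assumes \<epsilon>: "0 < \<epsilon>"
  shows "eventually (\<lambda>\<eta>. \<forall>x\<in>relative_changes n m M S \<Omega> \<omega> E f X \<eta>. x \<le> 1 / max_norm X * max_norm R + \<epsilon>) (at_right 0)"
proof -
  \<comment> \<open>\<open>P\<close> fixes admissibility only, so a property that holds eventually in \<open>G\<close> holds for all admissible
    tuples with a sufficiently small first component.\<close>
  define P where "P = {(\<eta>, \<Delta>, \<delta>, DX). (DX \<in> carrier_mat n m \<and>
        gv_mat n (gv_add \<Omega> \<Delta>) * (X + DX) = sparse_mat n m M S (\<lambda>k. \<omega> k + \<delta> k)) \<and>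
        gv_bounded n \<eta> E \<Delta> \<and> (\<forall>k\<in>{1..M}. \<bar>\<delta> k\<bar> \<le> \<eta> * f k)}"
  define G where "G = inf (filtercomap fst (at_right (0::real))) (principal P)"
  have fst: "filterlim fst (at_right 0) G"
    unfolding G_def by (rule filterlim_mono[OF filterlim_filtercomap order_refl]) simp
  then have \<eta>: "(fst \<longlongrightarrow> 0) G" by (rule filterlim_mono) (simp_all add: at_within_le_nhds)
  have pos: "eventually (\<lambda>z. 0 < fst z) G"
    using fst eventually_at_right_less[of 0] unfolding filterlim_iff by blast
  have inP: "eventually (\<lambda>z. z \<in> P) G" unfolding G_def by (simp add: eventually_inf_principal)
  let ?DX = "\<lambda>z. snd (snd (snd z))" and ?\<delta> = "\<lambda>z. fst (snd (snd z))" and ?\<Delta> = "\<lambda>z. fst (snd z)"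
  have bd: "eventually (\<lambda>z. gv_bounded n (fst z) E (?\<Delta> z)) G"
    using inP by eventually_elim (auto simp: P_def)
  have \<delta>: "eventually (\<lambda>z. \<forall>k\<in>{1..M}. \<bar>?\<delta> z k\<bar> \<le> fst z * f k) G"
    using inP by eventually_elim (auto simp: P_def)
  have sol: "eventually (\<lambda>z. ?DX z \<in> carrier_mat n m \<and>
      gv_mat n (gv_add \<Omega> (?\<Delta> z)) * (X + ?DX z) = sparse_mat n m M S (\<lambda>k. \<omega> k + ?\<delta> z k)) G"
    using inP by eventually_elim (auto simp: P_def)
  define e where "e = \<epsilon> * max_norm X"
  have e: "0 < e" using \<epsilon> X0 by (simp add: e_def)
  have entry: "eventually (\<lambda>z. \<bar>?DX z $$ (p, q)\<bar> \<le> fst z * (max_norm R + e)) G" if pq: "p < n" "q < m" for p q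
    using landau_o.smallD[OF gv_solution_first_order[OF \<eta> n Ai X S inv AX ok bd \<delta> sol pq] e] pos bd \<delta>
  proof eventually_elim
    case (elim z)
    let ?form = "gv_form n M \<Omega> (sens_B Ai S p q) (sens_D Ai X p q) (sens_V Ai (gv_mat n \<Omega>) X p q)
     (sens_W Ai (gv_mat n \<Omega>) X p q) (sens_L n \<Omega> Ai (gv_mat n \<Omega>) X p q) (sens_U n \<Omega> Ai (gv_mat n \<Omega>) X p q) (?\<Delta> z) (?\<delta> z)"
    have "\<bar>?form\<bar> \<le> fst z * R $$ (p, q)"
      unfolding cond_matrix_entry[OF n Ai gv_mat_carrier X S pq]
      using elim by (intro abs_gv_form_le) auto
    also have "\<dots> \<le> fst z * max_norm R"
      using abs_le_max_norm[OF cond_matrix_carrier pq, of M S \<Omega> E f Ai "gv_mat n \<Omega>" X] elim(2) by (intro mult_left_mono) auto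
    finally have "\<bar>?form\<bar> \<le> fst z * max_norm R" .
    then show ?case using elim(1,2) by (simp add: algebra_simps)
  qed
  then have "eventually (\<lambda>z. \<forall>(p, q)\<in>{..<n} \<times> {..<m}. \<bar>?DX z $$ (p, q)\<bar> \<le> fst z * (max_norm R + e)) G"
    by (intro eventually_ball_finite) auto
  then obtain Q where Q: "eventually Q (at_right 0)"
    "\<And>z. Q (fst z) \<Longrightarrow> z \<in> P \<Longrightarrow> \<forall>(p, q)\<in>{..<n} \<times> {..<m}. \<bar>?DX z $$ (p, q)\<bar> \<le> fst z * (max_norm R + e)"
    unfolding G_def eventually_inf_principal eventually_filtercomap by blast
  show ?thesis
    using Q(1) eventually_at_right_less[of "0::real"]
  proof eventually_elim
    case (elim \<eta>)
    show ?case
    proof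
      fix x assume "x \<in> relative_changes n m M S \<Omega> \<omega> E f X \<eta>"
      then obtain DX \<Delta> \<delta> where x: "x = 1 / \<eta> * (max_norm DX / max_norm X)"
        and inP: "(\<eta>, \<Delta>, \<delta>, DX) \<in> P" and DX: "DX \<in> carrier_mat n m"
        unfolding relative_changes_def P_def by auto
      obtain p q where pq: "p < n" "q < m" "max_norm DX = \<bar>DX $$ (p, q)\<bar>"
        using max_norm_attained[OF DX] n m by auto
      then have "max_norm DX \<le> \<eta> * (max_norm R + e)" using Q(2)[OF _ inP] elim(1) by auto
      then have "x \<le> 1 / \<eta> * (\<eta> * (max_norm R + e) / max_norm X)"
        unfolding x using elim(2) X0 by (intro mult_left_mono divide_right_mono) auto
      also have "\<dots> = 1 / max_norm X * max_norm R + \<epsilon>"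
        using elim(2) X0 by (simp add: e_def field_simps)
      finally show "x \<le> 1 / max_norm X * max_norm R + \<epsilon>" .
    qed
  qed
qed

text \<open>
  Along the vertices \<open>gv_worst\<close> for a fixed entry \<open>(p, q)\<close> at which \<open>\<bar>R\<bar>\<close> is largest, that entry of \<open>\<delta>X\<close> is
  \<open>\<eta> * max_norm R + o(\<eta>)\<close>.
\<close>
lemma relative_changes_lower:
  assumes \<epsilon>: "0 < \<epsilon>"
  shows "eventually (\<lambda>\<eta>. \<exists>x\<in>relative_changes n m M S \<Omega> \<omega> E f X \<eta>. 1 / max_norm X * max_norm R - \<epsilon> \<le> x) (at_right 0)"
proof -
  obtain p q where pq: "p < n" "q < m" and max: "max_norm R = \<bar>R $$ (p, q)\<bar>"
    using max_norm_attained[OF cond_matrix_carrier] n m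
    by (metis less_eq_Suc_le One_nat_def)
  let ?A = "gv_mat n \<Omega>"
  let ?\<Delta> = "gv_worst \<Omega> (sens_D Ai X p q) (sens_V Ai ?A X p q) (sens_W Ai ?A X p q) (sens_L n \<Omega> Ai ?A X p q) (sens_U n \<Omega> Ai ?A X p q) E"
  let ?\<delta> = "\<lambda>\<eta> k. \<eta> * f k * sgn (sens_B Ai S p q k)"
  let ?sol = "\<lambda>\<eta> D. D \<in> carrier_mat n m \<and> gv_mat n (gv_add \<Omega> (?\<Delta> \<eta>)) * (X + D) = sparse_mat n m M S (\<lambda>k. \<omega> k + ?\<delta> \<eta> k)"
  define DX where "DX \<eta> = (SOME D. ?sol \<eta> D)" for \<eta>
  have lim: "((\<lambda>\<eta>. \<eta>) \<longlongrightarrow> 0) (at_right (0::real))" by (rule tendsto_ident_at)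
  have pos: "eventually (\<lambda>\<eta>. 0 < \<eta>) (at_right (0::real))" by (rule eventually_at_right_less)
  then have bd: "eventually (\<lambda>\<eta>. gv_bounded n \<eta> E (?\<Delta> \<eta>)) (at_right 0)"
    by eventually_elim (intro gv_worst_bounded E, simp)
  have \<delta>: "eventually (\<lambda>\<eta>. \<forall>k\<in>{1..M}. \<bar>?\<delta> \<eta> k\<bar> \<le> \<eta> * f k) (at_right 0)"
    using pos
  proof eventually_elim
    case (elim \<eta>)
    show ?case
    proof
      fix k assume "k \<in> {1..M}"
      then show "\<bar>?\<delta> \<eta> k\<bar> \<le> \<eta> * f k" using f[of k] elim by (simp add: abs_mult abs_sgn_eq)
    qed
  qed
  have "sparse_mat n m M S w \<in> carrier_mat n m" for w by (simp add: sparse_mat_def mat_sum_def)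
  then have "eventually (\<lambda>\<eta>. \<exists>D\<in>carrier_mat n m. gv_mat n (gv_add \<Omega> (?\<Delta> \<eta>)) * (X + D)
      = sparse_mat n m M S (\<lambda>k. \<omega> k + ?\<delta> \<eta> k)) (at_right 0)"
    by (intro perturbed_system_solvable[OF gv_mat_carrier Ai inv gv_mat_carrier _ X gv_entries_tendsto[OF lim ok bd]])
  then have sol: "eventually (\<lambda>\<eta>. ?sol \<eta> (DX \<eta>)) (at_right 0)"
  proof eventually_elim
    case (elim \<eta>)
    then have "\<exists>D. ?sol \<eta> D" by blast
    then show ?case unfolding DX_def by (rule someI_ex)
  qed
  define e where "e = \<epsilon> * max_norm X"
  have e: "0 < e" using \<epsilon> X0 by (simp add: e_def)
  show ?thesis
    using landau_o.smallD[OF gv_solution_first_order[OF lim n Ai X S inv AX ok bd \<delta> sol pq] e] pos bd \<delta> sol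
  proof eventually_elim
    case (elim \<eta>)
    have "\<bar>DX \<eta> $$ (p, q) - \<eta> * R $$ (p, q)\<bar> \<le> e * \<eta>"
      using elim(1,2) unfolding cond_matrix_entry[OF n Ai gv_mat_carrier X S pq]
      by (simp add: gv_form_worst[OF _ E])
    moreover have "\<bar>\<eta> * R $$ (p, q)\<bar> = \<eta> * max_norm R" using max elim(2) by (simp add: abs_mult)
    ultimately have "\<eta> * max_norm R - e * \<eta> \<le> \<bar>DX \<eta> $$ (p, q)\<bar>" by linarith
    also have "\<dots> \<le> max_norm (DX \<eta>)" using elim(5) pq by (intro abs_le_max_norm) auto
    finally have "1 / \<eta> * ((\<eta> * max_norm R - e * \<eta>) / max_norm X) \<le> 1 / \<eta> * (max_norm (DX \<eta>) / max_norm X)"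
      using elim(2) X0 by (intro mult_left_mono divide_right_mono) auto
    moreover have "1 / \<eta> * ((\<eta> * max_norm R - e * \<eta>) / max_norm X) = 1 / max_norm X * max_norm R - \<epsilon>"
      using elim(2) X0 by (simp add: e_def field_simps)
    moreover have "1 / \<eta> * (max_norm (DX \<eta>) / max_norm X) \<in> relative_changes n m M S \<Omega> \<omega> E f X \<eta>"
      unfolding relative_changes_def mem_Collect_eq
      by (rule exI[of _ "DX \<eta>"], rule exI[of _ "?\<Delta> \<eta>"], rule exI[of _ "?\<delta> \<eta>"])
        (intro conjI refl elim(3) elim(4) elim(5)[THEN conjunct1] elim(5)[THEN conjunct2])
    ultimately show ?case by auto
  qed
qed

lemma sup_relative_change_tendsto:
  "(sup_relative_change n m M S \<Omega> \<omega> E f X \<longlongrightarrow> ereal (1 / max_norm X * max_norm R)) (at_right 0)"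
  unfolding sup_relative_change_def[abs_def]
  by (intro Sup_ereal_tendsto relative_changes_upper relative_changes_lower)

end

lemma mat_inv_left:
  assumes A: "A \<in> carrier_mat n n" and "invertible_mat A"
  shows "mat_inv A \<in> carrier_mat n n" "mat_inv A * A = 1\<^sub>m n"
proof -
  obtain C where C: "A * C = 1\<^sub>m n" "C * A = 1\<^sub>m (dim_row C)"
    using assms by (auto simp: invertible_mat_def inverts_mat_def)
  have "dim_row C = n" "dim_col C = n"
    using arg_cong[OF C(1), of dim_col] arg_cong[OF C(2), of dim_col] A by auto
  then have "C \<in> carrier_mat n n" by auto
  then have "A \<in> Units (ring_mat TYPE(real) n ())"
    using A C \<open>dim_row C = n\<close> by (auto simp: Units_def ring_mat_simps)
  then obtain D where "mat_inverse A = Some D"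
    using mat_inverse(1)[OF A] by (metis not_None_eq)
  then show "mat_inv A \<in> carrier_mat n n" "mat_inv A * A = 1\<^sub>m n"
    using mat_inverse(2)[OF A] by (auto simp: mat_inv_def)
qed

theorem theorem4p2:
  fixes n m M :: nat
    and A B X :: "real mat"
    and S :: "nat \<Rightarrow> real mat"
    and \<Omega> E :: gv_params
    and \<omega> f :: "nat \<Rightarrow> real"
  assumes "2 \<le> n" and "1 \<le> m"
    and "A \<in> carrier_mat n n" and "invertible_mat A" and "quasiseparable n 1 1 A"
    and "A = gv_mat n \<Omega>"
    and "\<And>k. k \<in> {1..M} \<Longrightarrow> S k \<in> carrier_mat n m"
    and "B = sparse_mat n m M S \<omega>"
    and "X \<in> carrier_mat n m"
    and "\<And>p q. p < n \<Longrightarrow> q < m \<Longrightarrow> X $$ (p, q) \<noteq> 0"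
    and "A * X = B"
    and "\<And>k. k \<in> {1..M} \<Longrightarrow> 0 \<le> f k"
    and "gv_nonneg n E"
    and "gv_quotients_ok n \<Omega> E"
  shows "(sup_relative_change n m M S \<Omega> \<omega> E f X \<longlongrightarrow> cond_GV n m M S \<Omega> \<omega> E f X) (at_right 0) \<and>
    cond_GV n m M S \<Omega> \<omega> E f X = ereal (1 / max_norm X * max_norm (
        mat_sum n m (\<lambda>k. f k \<cdot>\<^sub>m abs_mat (mat_inv A * S k)) {1..M}
      + abs_mat (mat_inv A) * abs_mat (D_d n E) * abs_mat X
      + abs_mat (mat_inv A * strict_lower A) * abs_mat (D_v n \<Omega> E) * abs_mat X
      + abs_mat (mat_inv A) * abs_mat (D_w n \<Omega> E) * abs_mat (strict_upper A * X)
      + mat_sum n m (\<lambda>i. \<bar>gl E i / gl \<Omega> i\<bar> \<cdot>\<^sub>m abs_mat (mat_inv A * lower_block n \<Omega> A i * X)) {2..n-1}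
      + mat_sum n m (\<lambda>i. \<bar>gu E i / gu \<Omega> i\<bar> \<cdot>\<^sub>m abs_mat (mat_inv A * upper_block n \<Omega> A i * X)) {2..n-1}))"
proof -
  note inv = mat_inv_left[OF assms(3,4)]
  have "0 < \<bar>X $$ (0, 0)\<bar>" using assms(1,2,10) by auto
  also have "\<dots> \<le> max_norm X" using assms(1,2) by (intro abs_le_max_norm[OF assms(9)]) auto
  finally have X0: "0 < max_norm X" .
  interpret gv_system n m M "mat_inv A" X S \<Omega> E \<omega> f
    using assms inv X0 by unfold_locales auto
  have lim: "(sup_relative_change n m M S \<Omega> \<omega> E f X \<longlongrightarrow>
      ereal (1 / max_norm X * max_norm (cond_matrix n m M S \<Omega> E f (mat_inv A) A X))) (at_right 0)"
    using sup_relative_change_tendsto unfolding assms(6)[symmetric] .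
  then have "cond_GV n m M S \<Omega> \<omega> E f X = ereal (1 / max_norm X * max_norm (cond_matrix n m M S \<Omega> E f (mat_inv A) A X))"
    unfolding cond_GV_def by (intro tendsto_Lim) simp
  with lim show ?thesis unfolding cond_matrix_def by simp
qed

end
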